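(* Let $d\ge1$, let $\mathbf W$ be the $d$-variate Wiener sheet, and let $\mathbf W_M(\mathbf t)=\Sigma_1\circ\cdots\circ\Sigma_d\mathbf W(\mathbf t)$, $\mathbf t\in[0,1]^d$, be the $d$-variate mean-centered Wiener sheet. Then the Karhunen–Loève (KL) expansion of $\mathbf W_M$ is given, for $\mathbf t=(t_1,\ldots,t_d)\in[0,1]^d$, by $$\mathbf W_M(\mathbf t)\stackrel{\text{law}}{=}\sum_{k_1=1}^\infty\cdots\sum_{k_d=1}^\infty\omega_{k_1,\ldots,k_d}\Big\{\prod_{i=1}^d\Big(\frac{\sqrt2\,\cos(k_i\pi t_i)}{k_i\pi}\Big)\Big\},$$ where $\{\omega_{k_1,\ldots,k_d}:k_1\ge1,\ldots,k_d\ge1\}$ is an array of i.i.d. $N(0,1)$ random variables.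
   Context: $\stackrel{\text{law}}{=}$ denotes equality in distribution (of processes). The $d$-variate Wiener sheet $\mathbf W$ is the centered Gaussian process, continuous on $\mathbb R_+^d$, with covariance $E(\mathbf W(\mathbf s)\mathbf W(\mathbf t))=\prod_{i=1}^d(s_i\wedge t_i)$. For $f\in L^1([0,1]^d)$ and $i=1,\ldots,d$, $\Sigma_if(\mathbf t)=f(\mathbf t)-\int_0^1f(t_1,\ldots,t_{i-1},u,t_{i+1},\ldots,t_d)\,du$. For a centered Gaussian process $\{\zeta(\mathbf t):\mathbf t\in[0,1]^d\}$ with covariance function $K_\zeta(\mathbf s,\mathbf t)=E(\zeta(\mathbf s)\zeta(\mathbf t))\in L^2([0,1]^d\times[0,1]^d)$, the KL expansion of $\zeta$ is the representation (convergent in expected mean squares) $\zeta(\mathbf t)\stackrel{\text{law}}{=}\sum_{k}\omega_k\sqrt{\lambda_k}\,e_k(\mathbf t)$, where $k$ ranges over a countable index set, $\{\omega_k\}$ are i.i.d. $N(0,1)$, $\{e_k\}$ is an orthonormal family in $L^2([0,1]^d)$, and the $\lambda_k\ge 0$ are the eigenvalues (repeated according to multiplicity; the eigenvalue $0$ may be omitted) of the Fredholm operator $T_\zeta h(\mathbf t)=\int_{[0,1]^d}K_\zeta(\mathbf s,\mathbf t)h(\mathbf s)\,d\mathbf s$ on $L^2([0,1]^d)$, with $T_\zeta e_k=\lambda_ke_k$. In the expansion of the claim, the eigenvalues are $\prod_{i=1}^d(k_i\pi)^{-2}$ and the orthonormal eigenfunctions are $\prod_{i=1}^d\sqrt2\cos(k_i\pi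 t_i)$. *)

theory Defs
  imports "HOL-Probability.Probability"
begin

abbreviation unit_cube :: "(real ^ 'n) set" where
  "unit_cube \<equiv> cbox 0 1"

abbreviation cube_measure :: "(real ^ 'n) measure" where
  "cube_measure \<equiv> restrict_space lborel unit_cube"

section \<open>Gaussian processes and the Wiener sheet\<close>

text \<open>
  The case split is needed because \<^const>\<open>normal_density\<close> is the zero function for
  variance zero; the degenerate Gaussian law is the point mass at the mean.
\<close>

definition centered_normal :: "'a measure \<Rightarrow> ('a \<Rightarrow> real) \<Rightarrow> bool" where
  "centered_normal M X \<longleftrightarrow>
     X \<in> borel_measurable M \<and>
     ((AE x in M. X x = 0) \<or>
      (\<exists>\<sigma>>0. distributed M lborel X (\<lambda>x. ennreal (normal_density 0 \<sigma> x))))"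

definition centered_gaussian_process ::
    "'a measure \<Rightarrow> 't set \<Rightarrow> ('t \<Rightarrow> 'a \<Rightarrow> real) \<Rightarrow> bool" where
  "centered_gaussian_process M T X \<longleftrightarrow>
     prob_space M \<and>
     (\<forall>F a. finite F \<and> F \<subseteq> T \<longrightarrow> centered_normal M (\<lambda>x. \<Sum>t\<in>F. a t * X t x))"

definition cov_fun :: "'a measure \<Rightarrow> ('t \<Rightarrow> 'a \<Rightarrow> real) \<Rightarrow> 't \<Rightarrow> 't \<Rightarrow> real" where
  "cov_fun M X s t = (LINT x|M. X s x * X t x)"

definition wiener_sheet :: "'a measure \<Rightarrow> (real ^ 'n \<Rightarrow> 'a \<Rightarrow> real) \<Rightarrow> bool" where
  "wiener_sheet M W \<longleftrightarrow>
     centered_gaussian_process M {t. \<forall>i. 0 \<le> t $ i} W \<and>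
     (\<forall>x\<in>space M. continuous_on {t. \<forall>i. 0 \<le> t $ i} (\<lambda>t. W t x)) \<and>
     (\<forall>s t. (\<forall>i. 0 \<le> s $ i) \<and> (\<forall>i. 0 \<le> t $ i) \<longrightarrow>
        cov_fun M W s t = (\<Prod>i\<in>UNIV. min (s $ i) (t $ i)))"

definition mean_center :: "'n \<Rightarrow> (real ^ 'n \<Rightarrow> real) \<Rightarrow> real ^ 'n \<Rightarrow> real" where
  "mean_center i f t = f t - (LINT u:{0..1}|lborel. f (\<chi> j. if j = i then u else t $ j))"

text \<open>
  For \<open>coords = [i\<^sub>1, \<dots>, i\<^sub>d]\<close> this applies pathwise the composition
  \<open>mean_center i\<^sub>1 \<circ> \<dots> \<circ> mean_center i\<^sub>d\<close>.  The list fixes the numbering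
  of the coordinates, since the index type \<open>'n\<close> carries no order.
\<close>

definition mean_centered ::
    "'n list \<Rightarrow> (real ^ 'n \<Rightarrow> 'a \<Rightarrow> real) \<Rightarrow> real ^ 'n \<Rightarrow> 'a \<Rightarrow> real" where
  "mean_centered coords W t x = foldr mean_center coords (\<lambda>s. W s x) t"

section \<open>Laws of processes and random series\<close>

definition process_law :: "'a measure \<Rightarrow> 't set \<Rightarrow> ('t \<Rightarrow> 'a \<Rightarrow> real) \<Rightarrow> ('t \<Rightarrow> real) measure" where
  "process_law M T X = distr M (\<Pi>\<^sub>M t\<in>T. borel) (\<lambda>x. \<lambda>t\<in>T. X t x)"

definition iid_std_normal :: "'b measure \<Rightarrow> 'k set \<Rightarrow> ('k \<Rightarrow> 'b \<Rightarrow> real) \<Rightarrow> bool" where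
  "iid_std_normal N K \<omega> \<longleftrightarrow>
     prob_space N \<and>
     prob_space.indep_vars N (\<lambda>_. borel) \<omega> K \<and>
     (\<forall>k\<in>K. distributed N lborel (\<omega> k) (\<lambda>x. ennreal (std_normal_density x)))"

text \<open>
  Unconditional convergence in mean square, as a net over the finite subsets of the index set.
  The nonnegative integral is used so that a difference that is not square integrable
  counts as infinitely far away (the Bochner integral would be 0).
\<close>

definition mean_square_sums ::
    "'b measure \<Rightarrow> 'k set \<Rightarrow> ('k \<Rightarrow> 'b \<Rightarrow> real) \<Rightarrow> ('b \<Rightarrow> real) \<Rightarrow> bool" where
  "mean_square_sums N K Y Z \<longleftrightarrow>
     (\<forall>k\<in>K. Y k \<in> borel_measurable N) \<and> Z \<in> borel_measurable N \<and>
     ((\<lambda>F. \<integral>\<^sup>+ x. ennreal ((Z x - (\<Sum>k\<in>F. Y k x))\<^sup>2) \<partial>N) \<longlongrightarrow> 0)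
       (finite_subsets_at_top K)"

text \<open>
  The process \<open>X\<close> on \<open>M\<close> equals in law the sum over \<open>k \<in> K\<close> of the processes \<open>Y k\<close> on \<open>N\<close>.
  Mean-square limits are almost surely unique, so the law does not depend on the choice of \<open>Z\<close>.
\<close>

definition law_eq_series ::
    "'a measure \<Rightarrow> 't set \<Rightarrow> ('t \<Rightarrow> 'a \<Rightarrow> real) \<Rightarrow>
     'b measure \<Rightarrow> 'k set \<Rightarrow> ('k \<Rightarrow> 't \<Rightarrow> 'b \<Rightarrow> real) \<Rightarrow> bool" where
  "law_eq_series M T X N K Y \<longleftrightarrow>
     (\<forall>t\<in>T. X t \<in> borel_measurable M) \<and>
     (\<exists>Z. (\<forall>t\<in>T. mean_square_sums N K (\<lambda>k. Y k t) (Z t)) \<and>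
          process_law M T X = process_law N T Z)"

section \<open>Karhunen--Loeve expansions\<close>

definition square_integrable :: "'a measure \<Rightarrow> ('a \<Rightarrow> real) \<Rightarrow> bool" where
  "square_integrable M f \<longleftrightarrow> f \<in> borel_measurable M \<and> integrable M (\<lambda>x. (f x)\<^sup>2)"

definition orthonormal_family ::
    "'a measure \<Rightarrow> 'k set \<Rightarrow> ('k \<Rightarrow> 'a \<Rightarrow> real) \<Rightarrow> bool" where
  "orthonormal_family M K e \<longleftrightarrow>
     (\<forall>k\<in>K. square_integrable M (e k)) \<and>
     (\<forall>k\<in>K. \<forall>l\<in>K. (LINT t|M. e k t * e l t) = (if k = l then 1 else 0))"

definition fredholm ::
    "(real ^ 'n \<Rightarrow> real ^ 'n \<Rightarrow> real) \<Rightarrow> (real ^ 'n \<Rightarrow> real) \<Rightarrow> real ^ 'n \<Rightarrow> real" where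
  "fredholm \<kappa> h t = (LINT s|cube_measure. \<kappa> s t * h s)"

text \<open>Elements of \<open>L\<^sup>2\<close> are represented by functions, so equality is almost everywhere.\<close>

definition fredholm_eigenspace ::
    "(real ^ 'n \<Rightarrow> real ^ 'n \<Rightarrow> real) \<Rightarrow> real \<Rightarrow> (real ^ 'n \<Rightarrow> real) set" where
  "fredholm_eigenspace \<kappa> \<mu> =
     {h. square_integrable cube_measure h \<and> (AE t in cube_measure. fredholm \<kappa> h t = \<mu> * h t)}"

text \<open>
  The last conjunct says that the family lists every nonzero eigenvalue with its multiplicity:
  for each \<open>\<mu> \<noteq> 0\<close> the (orthonormal) functions \<open>e k\<close> with \<open>lam k = \<mu>\<close> are finitely many
  and span the whole eigenspace.  In particular \<open>\<mu>\<close> is not an eigenvalue if there is no such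
  \<open>k\<close>.  Eigenfunctions for the eigenvalue 0 may be omitted.
\<close>

definition fredholm_eigensystem ::
    "(real ^ 'n \<Rightarrow> real ^ 'n \<Rightarrow> real) \<Rightarrow> 'k set \<Rightarrow> ('k \<Rightarrow> real) \<Rightarrow>
     ('k \<Rightarrow> real ^ 'n \<Rightarrow> real) \<Rightarrow> bool" where
  "fredholm_eigensystem \<kappa> K lam e \<longleftrightarrow>
     orthonormal_family cube_measure K e \<and>
     (\<forall>k\<in>K. 0 \<le> lam k \<and> e k \<in> fredholm_eigenspace \<kappa> (lam k)) \<and>
     (\<forall>\<mu>. \<mu> \<noteq> 0 \<longrightarrow>
        finite {k\<in>K. lam k = \<mu>} \<and>
        (\<forall>h\<in>fredholm_eigenspace \<kappa> \<mu>. \<exists>c.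
           AE t in cube_measure. h t = (\<Sum>k\<in>{k\<in>K. lam k = \<mu>}. c k * e k t)))"

definition KL_expansion ::
    "'a measure \<Rightarrow> (real ^ 'n \<Rightarrow> 'a \<Rightarrow> real) \<Rightarrow> 'b measure \<Rightarrow> 'k set \<Rightarrow>
     ('k \<Rightarrow> 'b \<Rightarrow> real) \<Rightarrow> ('k \<Rightarrow> real) \<Rightarrow> ('k \<Rightarrow> real ^ 'n \<Rightarrow> real) \<Rightarrow> bool" where
  "KL_expansion M X N K \<omega> lam e \<longleftrightarrow>
     centered_gaussian_process M unit_cube X \<and>
     square_integrable (cube_measure \<Otimes>\<^sub>M cube_measure) (\<lambda>(s, t). cov_fun M X s t) \<and>
     countable K \<and>
     iid_std_normal N K \<omega> \<and>
     fredholm_eigensystem (cov_fun M X) K lam e \<and>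
     law_eq_series M unit_cube X N K (\<lambda>k t x. \<omega> k x * sqrt (lam k) * e k t)"

end

theory Submission
  imports Defs
begin

text \<open>
  The mean-centered sheet is a centered Gaussian process whose covariance is a product over the
  coordinates, and both halves of the expansion follow from a diagonalization of one factor.

  Centering Brownian motion on \<open>{0..1}\<close> turns its covariance \<open>min s t\<close> into
  \<open>centered_min s t = min s t - (s - s\<^sup>2 / 2) - (t - t\<^sup>2 / 2) + 1 / 3\<close>.  The classical series of
  \<open>cos (k * pi * u) / (k * pi)\<^sup>2\<close>, which is quadratic in \<open>u\<close> on a period, expands this kernel as
  the sum over \<open>k \<ge> 1\<close> of \<open>2 * cos (k * pi * s) * cos (k * pi * t) / (k * pi)\<^sup>2\<close>
  (\<open>centered_min_cosine_expansion\<close>).  Multiplying over the coordinates gives an absolutely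
  convergent expansion of the covariance of the centered sheet over multi-indices
  (\<open>sheet_kernel_expansion\<close>), in products of cosines, which are orthonormal on the cube.

  Such an expansion determines the spectrum of the integral operator: an eigenfunction for
  \<open>\<mu> \<noteq> 0\<close> is a series in the orthonormal functions, and comparing coefficients leaves only
  those that belong to the eigenvalue \<open>\<mu>\<close> (\<open>mercer_eigensystem\<close>).

  On the probabilistic side everything rests on the fact that almost sure limits of centered
  normal variables are centered normal and that their second moments converge
  (\<open>centered_normal_AE_limit\<close>).  Applied to Riemann sums it shows that centering in one
  coordinate preserves Gaussian processes, and it computes the new covariance
  (\<open>mean_center_gaussian_process\<close>).  Applied to partial sums it shows that the random series
  converges in mean square to a Gaussian process whose covariance is the sum of the expansion
  (\<open>gaussian_series\<close>).  The two processes have the same covariance, and a centered Gaussian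
  process is determined in law by its covariance (\<open>gaussian_process_law_unique\<close>).
\<close>

section \<open>Centered normal variables\<close>

lemma char_distr:
  assumes "Y \<in> borel_measurable M"
  shows "char (distr M borel Y) t = (CLINT x|M. iexp (t * Y x))"
  using assms unfolding char_def by (subst integral_distr) auto

text \<open>
  Point mass and proper normal law share one formula for the characteristic function once the
  variance is written as the second moment.  Working with this formula instead of densities
  removes the case distinction from everything that follows.
\<close>

lemma centered_normal_second_moment_char:
  assumes M: "prob_space M" and Y: "centered_normal M Y"
  shows "integrable M (\<lambda>x. (Y x)\<^sup>2)"
    and "char (distr M borel Y) t = complex_of_real (exp (- (LINT x|M. (Y x)\<^sup>2) * t\<^sup>2 / 2))"
proof -
  interpret prob_space M by (rule M)
  have [measurable]: "Y \<in> borel_measurable M"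
    using Y by (simp add: centered_normal_def)
  consider (zero) "AE x in M. Y x = 0"
    | (pos) \<sigma> where "\<sigma> > 0" "distributed M lborel Y (\<lambda>x. ennreal (normal_density 0 \<sigma> x))"
    using Y by (auto simp: centered_normal_def)
  then have "integrable M (\<lambda>x. (Y x)\<^sup>2) \<and>
      char (distr M borel Y) t = complex_of_real (exp (- (LINT x|M. (Y x)\<^sup>2) * t\<^sup>2 / 2))"
  proof cases
    case zero
    have "integrable M (\<lambda>x. (Y x)\<^sup>2) \<longleftrightarrow> integrable M (\<lambda>x. 0::real)"
      by (rule integrable_cong_AE) (use zero in auto)
    moreover have "(LINT x|M. (Y x)\<^sup>2) = (LINT x|M. 0)"
      by (rule integral_cong_AE) (use zero in auto)
    moreover have "(CLINT x|M. iexp (t * Y x)) = (CLINT x|M. 1)"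
      by (rule integral_cong_AE) (use zero in auto)
    ultimately show ?thesis
      by (simp add: char_distr prob_space)
  next
    case pos
    have E: "(LINT x|M. Y x) = 0"
      using normal_distributed_expectation[OF pos] .
    have V: "(LINT x|M. (Y x)\<^sup>2) = \<sigma>\<^sup>2"
      using normal_distributed_variance[OF pos] E by simp
    have I: "integrable M (\<lambda>x. (Y x)\<^sup>2)"
    proof (rule ccontr)
      assume "\<not> ?thesis"
      then have "(LINT x|M. (Y x)\<^sup>2) = 0" by (rule not_integrable_integral_eq)
      then show False using V pos by simp
    qed
    have S: "distributed M lborel (\<lambda>x. Y x / \<sigma>) std_normal_density"
      using normal_standard_normal_convert[OF pos(1), of Y 0] pos(2) by simp
    have "distr M borel (\<lambda>x. Y x / \<sigma>) = std_normal_distribution"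
      using distributed_distr_eq_density[OF S] by (simp cong: distr_cong)
    then have "char std_normal_distribution (t * \<sigma>) = (CLINT x|M. iexp (t * \<sigma> * (Y x / \<sigma>)))"
      using char_distr[of "\<lambda>x. Y x / \<sigma>" M "t * \<sigma>"] by simp
    also have "\<dots> = char (distr M borel Y) t"
      using pos by (simp add: char_distr)
    finally show ?thesis
      using I V by (simp add: char_std_normal_distribution power_mult_distrib mult.commute)
  qed
  then show "integrable M (\<lambda>x. (Y x)\<^sup>2)"
    "char (distr M borel Y) t = complex_of_real (exp (- (LINT x|M. (Y x)\<^sup>2) * t\<^sup>2 / 2))"
    by auto
qed

text \<open>
  Levy's uniqueness theorem turns the formula back into the law; \<open>v = 0\<close> gives the point mass
  at the origin.
\<close>

lemma centered_normalI_char: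
  assumes M: "prob_space M" and Y[measurable]: "Y \<in> borel_measurable M" and v: "0 \<le> v"
    and char: "\<And>t. char (distr M borel Y) t = complex_of_real (exp (- v * t\<^sup>2 / 2))"
  shows "centered_normal M Y" "(LINT x|M. (Y x)\<^sup>2) = v"
proof -
  interpret prob_space M by (rule M)
  have rd: "real_distribution (distr M borel Y)" by (rule real_distribution_distr) simp
  show *: "centered_normal M Y"
  proof (cases "v = 0")
    case True
    interpret R: prob_space "return borel (0::real)" by (rule prob_space_return) simp
    have "real_distribution (return borel (0::real))"
      by unfold_locales auto
    moreover have "char (distr M borel Y) = char (return borel 0)"
      using char True by (auto simp: char_def integral_return)
    ultimately have D: "distr M borel Y = return borel 0"
      using rd by (intro Levy_uniqueness) auto
    have "AE y in distr M borel Y. y = 0"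
      unfolding D by (subst AE_return) auto
    then have "AE x in M. Y x = 0"
      by (subst (asm) AE_distr_iff) auto
    then show ?thesis by (simp add: centered_normal_def)
  next
    case False
    define \<sigma> where "\<sigma> = sqrt v"
    have \<sigma>: "\<sigma> > 0" "\<sigma>\<^sup>2 = v" using v False by (auto simp: \<sigma>_def)
    define D where "D = density lborel (\<lambda>x. ennreal (normal_density 0 \<sigma> x))"
    interpret D: prob_space D unfolding D_def by (rule prob_space_normal_density) (rule \<sigma>)
    have [simp]: "sets D = sets borel" "space D = UNIV" by (auto simp: D_def)
    have [measurable_cong]: "sets D = sets borel" by simp
    have rD: "real_distribution D" by unfold_locales auto
    have dD: "distributed D lborel (\<lambda>x. x) (\<lambda>x. ennreal (normal_density 0 \<sigma> x))"
      unfolding distributed_def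
      by (auto simp: D_def distr_id2 intro!: distr_id2)
    then have cD: "centered_normal D (\<lambda>x. x)"
      using \<sigma> by (auto simp: centered_normal_def)
    have "(LINT x|D. x\<^sup>2) = \<sigma>\<^sup>2"
      using D.normal_distributed_variance[OF \<sigma>(1) dD] D.normal_distributed_expectation[OF \<sigma>(1) dD] by simp
    then have "char (distr D borel (\<lambda>x. x)) t = complex_of_real (exp (- v * t\<^sup>2 / 2))" for t
      using centered_normal_second_moment_char(2)[OF D.prob_space_axioms cD] \<sigma> by simp
    moreover have "distr D borel (\<lambda>x. x) = D" by (rule distr_id2) simp
    ultimately have "char (distr M borel Y) = char D" using char by auto
    then have "distr M borel Y = D" by (intro Levy_uniqueness rd rD)
    then have "distributed M lborel Y (\<lambda>x. ennreal (normal_density 0 \<sigma> x))"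
      unfolding distributed_def D_def by (auto cong: distr_cong)
    then show ?thesis using \<sigma> by (auto simp: centered_normal_def)
  qed
  show "(LINT x|M. (Y x)\<^sup>2) = v"
    using centered_normal_second_moment_char(2)[OF M *, of 1] char[of 1] by simp
qed

text \<open>
  Characteristic functions converge along almost sure limits by dominated convergence.  A limit of
  functions \<open>exp (- v j * t\<^sup>2 / 2)\<close> that is continuous at \<open>0\<close> forces the variances \<open>v j\<close> to
  converge, so the limit law is again centered normal and no second moment is lost, although
  almost sure convergence alone would not control it.
\<close>

lemma centered_normal_AE_limit:
  assumes M: "prob_space M" and Y: "\<And>j. centered_normal M (Y j)"
    and Z[measurable]: "Z \<in> borel_measurable M"
    and lim: "AE x in M. (\<lambda>j. Y j x) \<longlonglongrightarrow> Z x"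
  shows "centered_normal M Z" "(\<lambda>j. LINT x|M. (Y j x)\<^sup>2) \<longlonglongrightarrow> (LINT x|M. (Z x)\<^sup>2)"
proof -
  interpret prob_space M by (rule M)
  have [measurable]: "Y j \<in> borel_measurable M" for j
    using Y by (simp add: centered_normal_def)
  define v where "v j = (LINT x|M. (Y j x)\<^sup>2)" for j
  define \<phi> where "\<phi> = char (distr M borel Z)"
  have conv: "(\<lambda>j. complex_of_real (exp (- v j * t\<^sup>2 / 2))) \<longlonglongrightarrow> \<phi> t" for t
  proof -
    have "(\<lambda>j. CLINT x|M. iexp (t * Y j x)) \<longlonglongrightarrow> (CLINT x|M. iexp (t * Z x))"
    proof (rule integral_dominated_convergence[where w="\<lambda>_. 1"])
      show "AE x in M. (\<lambda>j. iexp (t * Y j x)) \<longlonglongrightarrow> iexp (t * Z x)"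
        using lim by eventually_elim (auto intro!: tendsto_intros)
    qed auto
    then show ?thesis
      using centered_normal_second_moment_char(2)[OF M Y]
      by (simp add: char_distr \<phi>_def v_def)
  qed
  interpret R: real_distribution "distr M borel Z" by (rule real_distribution_distr) simp
  \<comment> \<open>Near zero the limit characteristic function does not vanish, so the variances can be
    recovered from it by a logarithm.\<close>
  have "(\<phi> \<longlongrightarrow> 1) (at 0)"
    using R.isCont_char[of 0] R.char_zero by (simp add: \<phi>_def isCont_def)
  then have "\<forall>\<^sub>F t in at 0. \<phi> t \<noteq> 0" by (rule tendsto_imp_eventually_ne) simp
  moreover have "\<forall>\<^sub>F t in at 0. t \<noteq> (0::real)" by (simp add: eventually_at_filter)
  ultimately have "\<forall>\<^sub>F t in at 0. \<phi> t \<noteq> 0 \<and> t \<noteq> 0" by eventually_elim simp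
  then obtain t0 where t0: "\<phi> t0 \<noteq> 0" "t0 \<noteq> 0"
    using eventually_happens trivial_limit_at by blast
  have "(\<lambda>j. norm (complex_of_real (exp (- v j * t0\<^sup>2 / 2)))) \<longlonglongrightarrow> norm (\<phi> t0)"
    by (intro tendsto_norm conv)
  then have "(\<lambda>j. exp (- v j * t0\<^sup>2 / 2)) \<longlonglongrightarrow> norm (\<phi> t0)" by simp
  then have "(\<lambda>j. ln (exp (- v j * t0\<^sup>2 / 2))) \<longlonglongrightarrow> ln (norm (\<phi> t0))"
    by (rule tendsto_ln) (use t0 in auto)
  then have "(\<lambda>j. (- v j * t0\<^sup>2 / 2) * (- 2 / t0\<^sup>2)) \<longlonglongrightarrow> ln (norm (\<phi> t0)) * (- 2 / t0\<^sup>2)"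
    by (intro tendsto_mult_right) simp
  then obtain w where w: "v \<longlonglongrightarrow> w"
    using t0 by auto
  have "w \<ge> 0"
    by (rule LIMSEQ_le_const[OF w]) (auto simp: v_def)
  have "(\<lambda>j. complex_of_real (exp (- v j * t\<^sup>2 / 2))) \<longlonglongrightarrow> complex_of_real (exp (- w * t\<^sup>2 / 2))" for t
    by (intro tendsto_intros w) auto
  then have "\<phi> t = complex_of_real (exp (- w * t\<^sup>2 / 2))" for t
    using LIMSEQ_unique conv by blast
  note * = centered_normalI_char[OF M Z \<open>w \<ge> 0\<close> this[unfolded \<phi>_def]]
  show "centered_normal M Z" by (rule *)
  show "(\<lambda>j. LINT x|M. (Y j x)\<^sup>2) \<longlonglongrightarrow> (LINT x|M. (Z x)\<^sup>2)"
    using w *(2) by (simp add: v_def[abs_def])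
qed

section \<open>Centered Gaussian processes\<close>

text \<open>
  The points \<open>p i\<close> may coincide, so coefficients are first collected per point.
\<close>

lemma gaussian_process_sum:
  assumes X: "centered_gaussian_process M T X" and I: "finite I" "p ` I \<subseteq> T"
  shows "centered_normal M (\<lambda>x. \<Sum>i\<in>I. a i * X (p i) x)"
proof -
  have "(\<Sum>i\<in>I. a i * X (p i) x) = (\<Sum>t\<in>p ` I. (\<Sum>i | i \<in> I \<and> p i = t. a i) * X t x)" for x
    by (subst sum.image_gen[OF I(1), of _ p]) (auto simp: sum_distrib_right intro!: sum.cong)
  then show ?thesis
    using X I unfolding centered_gaussian_process_def by auto
qed

lemma gaussian_process_sum2:
  assumes X: "centered_gaussian_process M T X" and "s \<in> T" "t \<in> T"
  shows "centered_normal M (\<lambda>x. a * X s x + b * X t x)"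
  using gaussian_process_sum[OF X, of "{0, 1::nat}" "\<lambda>i. if i = 0 then s else t"
      "\<lambda>i. if i = 0 then a else b"] assms by simp

lemma gaussian_process_measurable:
  assumes X: "centered_gaussian_process M T X" and "t \<in> T"
  shows "X t \<in> borel_measurable M"
  using gaussian_process_sum2[OF X assms(2,2), of 1 0] by (simp add: centered_normal_def)

lemma gaussian_process_integrable:
  assumes X: "centered_gaussian_process M T X" and st: "s \<in> T" "t \<in> T"
  shows "integrable M (\<lambda>x. X s x * X t x)"
proof -
  have M: "prob_space M" using X by (simp add: centered_gaussian_process_def)
  have [measurable]: "X s \<in> borel_measurable M" "X t \<in> borel_measurable M"
    using gaussian_process_measurable[OF X] st by auto
  have "integrable M (\<lambda>x. (X t x)\<^sup>2)" if "t \<in> T" for t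
    using centered_normal_second_moment_char(1)[OF M gaussian_process_sum2[OF X that that, of 1 0]]
    by simp
  then have "integrable M (\<lambda>x. (X s x)\<^sup>2 + (X t x)\<^sup>2)"
    using st by auto
  then show ?thesis
  proof (rule Bochner_Integration.integrable_bound)
    have "\<bar>a * b\<bar> \<le> a\<^sup>2 + b\<^sup>2" for a b :: real
    proof -
      have "2 * \<bar>a\<bar> * \<bar>b\<bar> \<le> \<bar>a\<bar>\<^sup>2 + \<bar>b\<bar>\<^sup>2" by (rule sum_squares_bound)
      moreover have "0 \<le> \<bar>a\<bar> * \<bar>b\<bar>" by simp
      ultimately show ?thesis unfolding abs_mult power2_abs by linarith
    qed
    then show "AE x in M. norm (X s x * X t x) \<le> norm ((X s x)\<^sup>2 + (X t x)\<^sup>2)"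
      by (auto intro: order_trans[OF _ abs_ge_self])
  qed auto
qed

lemma gaussian_process_cov_sum:
  assumes X: "centered_gaussian_process M T X"
    and I: "p ` I \<subseteq> T" and J: "q ` J \<subseteq> T"
  shows "(LINT x|M. (\<Sum>i\<in>I. a i * X (p i) x) * (\<Sum>j\<in>J. b j * X (q j) x)) =
    (\<Sum>i\<in>I. \<Sum>j\<in>J. a i * b j * cov_fun M X (p i) (q j))"
proof -
  have *: "integrable M (\<lambda>x. X (p i) x * X (q j) x)" if "i \<in> I" "j \<in> J" for i j
    using that I J by (intro gaussian_process_integrable[OF X]) auto
  have "(LINT x|M. (\<Sum>i\<in>I. a i * X (p i) x) * (\<Sum>j\<in>J. b j * X (q j) x)) =
      (LINT x|M. (\<Sum>i\<in>I. \<Sum>j\<in>J. a i * b j * (X (p i) x * X (q j) x)))"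
    by (simp add: sum_product algebra_simps)
  also have "\<dots> = (\<Sum>i\<in>I. \<Sum>j\<in>J. a i * b j * cov_fun M X (p i) (q j))"
    unfolding cov_fun_def
    by (subst Bochner_Integration.integral_sum Bochner_Integration.integrable_sum,
        (intro Bochner_Integration.integrable_sum integrable_mult_right *; assumption),
        intro sum.cong refl)+ simp
  finally show ?thesis .
qed

text \<open>
  Covariances become second moments of single centered normal variables, to which the limit
  theorem for such variables applies.
\<close>

lemma cov_fun_polarization:
  assumes X: "centered_gaussian_process M T X" and st: "s \<in> T" "t \<in> T"
  shows "cov_fun M X s t = ((LINT x|M. (1 * X s x + 1 * X t x)\<^sup>2) - (LINT x|M. (1 * X s x + (- 1) * X t x)\<^sup>2)) / 4"
proof -
  have M: "prob_space M" using X by (simp add: centered_gaussian_process_def)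
  have "(LINT x|M. (1 * X s x + 1 * X t x)\<^sup>2) - (LINT x|M. (1 * X s x + (- 1) * X t x)\<^sup>2) =
      (LINT x|M. (1 * X s x + 1 * X t x)\<^sup>2 - (1 * X s x + (- 1) * X t x)\<^sup>2)"
    by (intro Bochner_Integration.integral_diff[symmetric]
        centered_normal_second_moment_char(1)[OF M] gaussian_process_sum2[OF X] st)
  also have "\<dots> = (LINT x|M. 4 * (X s x * X t x))"
    by (simp add: power2_eq_square algebra_simps)
  finally show ?thesis by (simp add: cov_fun_def)
qed

lemma gaussian_process_AE_limit:
  assumes X: "\<And>j. centered_gaussian_process M T (X j)"
    and Z: "\<And>t. t \<in> T \<Longrightarrow> Z t \<in> borel_measurable M"
    and lim: "\<And>t. t \<in> T \<Longrightarrow> AE x in M. (\<lambda>j. X j t x) \<longlonglongrightarrow> Z t x"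
  shows "centered_gaussian_process M T Z"
    and "\<lbrakk>s \<in> T; t \<in> T\<rbrakk> \<Longrightarrow> (\<lambda>j. cov_fun M (X j) s t) \<longlonglongrightarrow> cov_fun M Z s t"
proof -
  have M: "prob_space M" using X by (simp add: centered_gaussian_process_def)
  show *: "centered_gaussian_process M T Z"
    unfolding centered_gaussian_process_def
  proof (intro conjI M allI impI)
    fix F and a :: "_ \<Rightarrow> real" assume F: "finite F \<and> F \<subseteq> T"
    show "centered_normal M (\<lambda>x. \<Sum>t\<in>F. a t * Z t x)"
    proof (rule centered_normal_AE_limit(1)[OF M, where Y="\<lambda>j x. \<Sum>t\<in>F. a t * X j t x"])
      show "centered_normal M (\<lambda>x. \<Sum>t\<in>F. a t * X j t x)" for j
        using X F unfolding centered_gaussian_process_def by auto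
      have "AE x in M. \<forall>t\<in>F. (\<lambda>j. X j t x) \<longlonglongrightarrow> Z t x"
        using F lim by (intro AE_finite_allI) auto
      then show "AE x in M. (\<lambda>j. \<Sum>t\<in>F. a t * X j t x) \<longlonglongrightarrow> (\<Sum>t\<in>F. a t * Z t x)"
        by eventually_elim (auto intro!: tendsto_intros)
      show "(\<lambda>x. \<Sum>t\<in>F. a t * Z t x) \<in> borel_measurable M"
        using F Z by (intro borel_measurable_sum borel_measurable_times) auto
    qed
  qed
  assume st: "s \<in> T" "t \<in> T"
  have "(\<lambda>j. LINT x|M. (a * X j s x + b * X j t x)\<^sup>2) \<longlonglongrightarrow> (LINT x|M. (a * Z s x + b * Z t x)\<^sup>2)" for a b
  proof (rule centered_normal_AE_limit(2)[OF M])
    show "centered_normal M (\<lambda>x. a * X j s x + b * X j t x)" for j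
      by (rule gaussian_process_sum2[OF X st])
    show "AE x in M. (\<lambda>j. a * X j s x + b * X j t x) \<longlonglongrightarrow> a * Z s x + b * Z t x"
      using lim[OF st(1)] lim[OF st(2)] by eventually_elim (auto intro!: tendsto_intros)
    show "(\<lambda>x. a * Z s x + b * Z t x) \<in> borel_measurable M"
      using Z st by (intro borel_measurable_add borel_measurable_times) auto
  qed
  note this[of 1 1] this[of 1 "- 1"]
  from tendsto_divide[OF tendsto_diff[OF this] tendsto_const[of 4]]
  show "(\<lambda>j. cov_fun M (X j) s t) \<longlonglongrightarrow> cov_fun M Z s t"
    unfolding cov_fun_polarization[OF X st] cov_fun_polarization[OF * st] by simp
qed

text \<open>
  A Fourier uniqueness statement for the image under \<open>Y\<close> of the finite measure with density
  \<open>w\<close>: after division by the total mass it is Levy's theorem for probability measures.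
\<close>

lemma weighted_law_unique:
  fixes w Y :: "'a \<Rightarrow> real" and w' Y' :: "'b \<Rightarrow> real"
  assumes M: "prob_space M" and N: "prob_space N"
    and [measurable]: "w \<in> borel_measurable M" "Y \<in> borel_measurable M"
      "w' \<in> borel_measurable N" "Y' \<in> borel_measurable N" "A \<in> sets borel"
    and w: "\<And>x. 0 \<le> w x" "\<And>x. w x \<le> C" and w': "\<And>x. 0 \<le> w' x" "\<And>x. w' x \<le> C"
    and cos: "\<And>\<xi>. (LINT x|M. w x * cos (\<xi> * Y x)) = (LINT x|N. w' x * cos (\<xi> * Y' x))"
    and sin: "\<And>\<xi>. (LINT x|M. w x * sin (\<xi> * Y x)) = (LINT x|N. w' x * sin (\<xi> * Y' x))"
  shows "(LINT x|M. indicator A (Y x) * w x) = (LINT x|N. indicator A (Y' x) * w' x)"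
proof -
  have aux: "((LINT x|M. w x) = 0 \<longrightarrow> (LINT x|M. indicator A (Y x) * w x) = 0) \<and>
      ((LINT x|M. w x) \<noteq> 0 \<longrightarrow> real_distribution (distr (density M (\<lambda>x. ennreal (w x / (LINT x|M. w x)))) borel Y) \<and>
         (\<forall>\<xi>. char (distr (density M (\<lambda>x. ennreal (w x / (LINT x|M. w x)))) borel Y) \<xi> =
            Complex ((LINT x|M. w x * cos (\<xi> * Y x)) / (LINT x|M. w x)) ((LINT x|M. w x * sin (\<xi> * Y x)) / (LINT x|M. w x))) \<and>
         measure (distr (density M (\<lambda>x. ennreal (w x / (LINT x|M. w x)))) borel Y) A =
           (LINT x|M. indicator A (Y x) * w x) / (LINT x|M. w x))"
    if M: "prob_space M" and [measurable]: "w \<in> borel_measurable M" "Y \<in> borel_measurable M"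
      and w: "\<And>x. 0 \<le> w x" "\<And>x. w x \<le> C"
    for M :: "'c measure" and w Y :: "'c \<Rightarrow> real"
  proof -
    interpret prob_space M by (rule M)
    have I: "integrable M w"
      by (rule integrable_const_bound[where B=C]) (use w in auto)
    define m where "m = (LINT x|M. w x)"
    have "0 \<le> m" unfolding m_def using w by simp
    have z: "(LINT x|M. indicator A (Y x) * w x) = 0" if "m = 0"
    proof -
      have "AE x in M. w x = 0"
        using that integral_nonneg_eq_0_iff_AE[OF I] w by (auto simp: m_def)
      then have "(LINT x|M. indicator A (Y x) * w x) = (LINT x|M. 0)"
        by (intro integral_cong_AE) auto
      then show ?thesis by simp
    qed
    moreover have "real_distribution (distr (density M (\<lambda>x. ennreal (w x / m))) borel Y) \<and>
        (\<forall>\<xi>. char (distr (density M (\<lambda>x. ennreal (w x / m))) borel Y) \<xi> =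
            Complex ((LINT x|M. w x * cos (\<xi> * Y x)) / m) ((LINT x|M. w x * sin (\<xi> * Y x)) / m)) \<and>
         measure (distr (density M (\<lambda>x. ennreal (w x / m))) borel Y) A =
           (LINT x|M. indicator A (Y x) * w x) / m" if "m \<noteq> 0"
    proof -
      have m: "m > 0" using \<open>0 \<le> m\<close> that by simp
      define D where "D = density M (\<lambda>x. ennreal (w x / m))"
      have [measurable_cong]: "sets D = sets M" by (simp add: D_def)
      have "emeasure D (space D) = (\<integral>\<^sup>+x. ennreal (w x / m) \<partial>M)"
        unfolding D_def by (subst emeasure_density) (auto intro!: nn_integral_cong)
      also have "\<dots> = ennreal (LINT x|M. w x / m)"
        using I w m by (intro nn_integral_eq_integral) auto
      also have "\<dots> = 1" using m by (simp add: m_def)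
      finally interpret D: prob_space D by (rule prob_spaceI)
      have rd: "real_distribution (distr D borel Y)"
        by (rule D.real_distribution_distr) simp
      have ch: "char (distr D borel Y) \<xi> =
            Complex ((LINT x|M. w x * cos (\<xi> * Y x)) / m) ((LINT x|M. w x * sin (\<xi> * Y x)) / m)" for \<xi>
      proof -
        have i: "integrable M (\<lambda>x. (w x / m) *\<^sub>R iexp (\<xi> * Y x))"
          by (rule integrable_const_bound[where B="C / m"])
            (use w m in \<open>auto simp: norm_mult divide_right_mono\<close>)
        have "char (distr D borel Y) \<xi> = (CLINT x|D. iexp (\<xi> * Y x))"
          by (rule char_distr) simp
        also have "\<dots> = (CLINT x|M. (w x / m) *\<^sub>R iexp (\<xi> * Y x))"
          unfolding D_def by (rule integral_density) (use w m in auto)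
        finally have "char (distr D borel Y) \<xi> = \<dots>" .
        moreover have "Re (CLINT x|M. (w x / m) *\<^sub>R iexp (\<xi> * Y x)) = (LINT x|M. w x * cos (\<xi> * Y x)) / m"
          using i by (subst integral_Re[symmetric]) (simp_all add: Re_exp Im_exp)
        moreover have "Im (CLINT x|M. (w x / m) *\<^sub>R iexp (\<xi> * Y x)) = (LINT x|M. w x * sin (\<xi> * Y x)) / m"
          using i by (subst integral_Im[symmetric]) (simp_all add: Re_exp Im_exp)
        ultimately show ?thesis by (metis complex.collapse)
      qed
      have "measure (distr D borel Y) A = (LINT y|distr D borel Y. indicator A y)"
        by simp
      also have "\<dots> = (LINT x|D. indicator A (Y x))"
        by (rule integral_distr) auto
      also have "\<dots> = (LINT x|M. (w x / m) *\<^sub>R indicator A (Y x))"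
        unfolding D_def by (rule integral_density) (use w m in auto)
      also have "\<dots> = (LINT x|M. indicator A (Y x) * w x) / m"
        by (simp add: mult.commute)
      finally show ?thesis using rd ch by (simp add: D_def)
    qed
    ultimately show ?thesis by (simp add: m_def)
  qed
  have m: "(LINT x|M. w x) = (LINT x|N. w' x)" using cos[of 0] by simp
  note a = aux[OF M, of w Y] and a' = aux[OF N, of w' Y']
  show ?thesis
  proof (cases "(LINT x|M. w x) = 0")
    case True
    then show ?thesis using a a' m w w' by simp
  next
    case False
    define D where "D = distr (density M (\<lambda>x. ennreal (w x / (LINT x|M. w x)))) borel Y"
    define D' where "D' = distr (density N (\<lambda>x. ennreal (w' x / (LINT x|N. w' x)))) borel Y'"
    have "D = D'"
      by (rule Levy_uniqueness)
        (use a a' m w w' False in \<open>auto simp: D_def D'_def cos sin\<close>)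
    moreover have "measure D A = (LINT x|M. indicator A (Y x) * w x) / (LINT x|M. w x)"
      using a w False by (simp add: D_def)
    moreover have "measure D' A = (LINT x|N. indicator A (Y' x) * w' x) / (LINT x|M. w x)"
      using a' w' False m by (simp add: D'_def)
    ultimately show ?thesis using False by simp
  qed
qed

lemma centered_normal_integral_cos:
  assumes M: "prob_space M" and Y: "centered_normal M Y"
  shows "(LINT x|M. cos (c + Y x)) = cos c * exp (- (LINT x|M. (Y x)\<^sup>2) / 2)"
proof -
  interpret prob_space M by (rule M)
  have [measurable]: "Y \<in> borel_measurable M"
    using Y by (simp add: centered_normal_def)
  have i: "integrable M (\<lambda>x. exp (\<i> * c) * iexp (Y x))"
    by (rule integrable_const_bound[where B=1]) (auto simp: norm_mult)
  have "(LINT x|M. cos (c + Y x)) = (LINT x|M. Re (exp (\<i> * c) * iexp (Y x)))"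
    by (simp add: Re_exp Im_exp cos_add)
  also have "\<dots> = Re (exp (\<i> * c) * (CLINT x|M. iexp (Y x)))"
    using i by (subst integral_Re) simp_all
  also have "(CLINT x|M. iexp (Y x)) = complex_of_real (exp (- (LINT x|M. (Y x)\<^sup>2) / 2))"
    using centered_normal_second_moment_char(2)[OF M Y, of 1] by (simp add: char_distr)
  finally show ?thesis by (simp add: Re_exp)
qed

text \<open>
  This is the step from one-dimensional to joint laws.  The integrals interpolate between the joint
  characteristic function (\<open>F\<close> empty) and the probabilities of rectangles (\<open>F = G\<close>, \<open>a = 0\<close>).
  One coordinate at a time is moved from the exponent into the rectangle, and each move needs only
  one-dimensional Fourier uniqueness, for a weighted measure.
\<close>

lemma gaussian_rectangle_cos_eq:
  fixes X :: "'t \<Rightarrow> 'a \<Rightarrow> real" and Z :: "'t \<Rightarrow> 'b \<Rightarrow> real"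
  assumes X: "centered_gaussian_process M T X" and Z: "centered_gaussian_process N T Z"
    and cov: "\<And>s t. \<lbrakk>s \<in> T; t \<in> T\<rbrakk> \<Longrightarrow> cov_fun M X s t = cov_fun N Z s t"
    and G: "finite G" "G \<subseteq> T" and F: "finite F" "F \<subseteq> G"
    and A: "\<And>t. A t \<in> sets borel"
  shows "(LINT x|M. (\<Prod>t\<in>F. indicator (A t) (X t x)) * cos (c + (\<Sum>t\<in>G. a t * X t x))) =
    (LINT x|N. (\<Prod>t\<in>F. indicator (A t) (Z t x)) * cos (c + (\<Sum>t\<in>G. a t * Z t x)))"
  using F
proof (induction F arbitrary: a c rule: finite_induct)
  case empty
  have M: "prob_space M" and N: "prob_space N"
    using X Z by (auto simp: centered_gaussian_process_def)
  have n: "centered_normal M (\<lambda>x. \<Sum>t\<in>G. a t * X t x)" "centered_normal N (\<lambda>x. \<Sum>t\<in>G. a t * Z t x)"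
    using X Z G unfolding centered_gaussian_process_def by auto
  have "(LINT x|M. (\<Sum>t\<in>G. a t * X t x)\<^sup>2) = (LINT x|N. (\<Sum>t\<in>G. a t * Z t x)\<^sup>2)"
    using gaussian_process_cov_sum[OF X, of "\<lambda>t. t" G "\<lambda>t. t" G a a]
      gaussian_process_cov_sum[OF Z, of "\<lambda>t. t" G "\<lambda>t. t" G a a] G cov
    by (simp add: power2_eq_square subset_iff)
  then show ?case
    using centered_normal_integral_cos[OF M n(1)] centered_normal_integral_cos[OF N n(2)] by simp
next
  case (insert u F)
  have M: "prob_space M" and N: "prob_space N"
    using X Z by (auto simp: centered_gaussian_process_def)
  interpret M: prob_space M by (rule M)
  interpret N: prob_space N by (rule N)
  have mX: "X t \<in> borel_measurable M" and mZ: "Z t \<in> borel_measurable N" if "t \<in> G" for t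
    using gaussian_process_measurable[OF X] gaussian_process_measurable[OF Z] that G by auto
  have u: "u \<in> G" "F \<subseteq> G" using insert by auto
  define P where "P x = (\<Prod>t\<in>F. indicator (A t) (X t x) :: real)" for x
  define Q where "Q x = (\<Prod>t\<in>F. indicator (A t) (Z t x) :: real)" for x
  define L where "L a x = (\<Sum>t\<in>G. a t * X t x)" for a x
  define K where "K a x = (\<Sum>t\<in>G. a t * Z t x)" for a x
  have [measurable]: "A t \<in> sets borel" for t by (rule A)
  have PQ: "0 \<le> P x" "P x \<le> 1" "0 \<le> Q y" "Q y \<le> 1" for x y
    by (auto simp: P_def Q_def intro!: prod_nonneg prod_le_1)
  have [measurable]: "P \<in> borel_measurable M" "L a \<in> borel_measurable M" "X u \<in> borel_measurable M" for a
    unfolding P_def[abs_def] L_def[abs_def] using mX u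
    by (auto intro!: borel_measurable_prod borel_measurable_sum borel_measurable_times
        borel_measurable_indicator' simp: subset_iff)
  have [measurable]: "Q \<in> borel_measurable N" "K a \<in> borel_measurable N" "Z u \<in> borel_measurable N" for a
    unfolding Q_def[abs_def] K_def[abs_def] using mZ u
    by (auto intro!: borel_measurable_prod borel_measurable_sum borel_measurable_times
        borel_measurable_indicator' simp: subset_iff)
  have IH: "(LINT x|M. P x * cos (c + L a x)) = (LINT x|N. Q x * cos (c + K a x))" for a c
    using insert.IH[of c a] u by (simp add: P_def Q_def L_def K_def)
  have upd: "L (a(u := a u + \<xi>)) x = L a x + \<xi> * X u x" "K (a(u := a u + \<xi>)) y = K a y + \<xi> * Z u y"
    for a \<xi> x y
    unfolding L_def K_def using G(1) u(1)
    by (simp_all add: sum.remove[where x=u] algebra_simps)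
  have iM: "integrable M (\<lambda>x. P x * cos (f x))" if "f \<in> borel_measurable M" for f
    by (rule M.integrable_const_bound[where B=1])
      (use that PQ in \<open>auto simp: abs_mult intro!: mult_le_one\<close>)
  have iN: "integrable N (\<lambda>x. Q x * cos (f x))" if "f \<in> borel_measurable N" for f
    by (rule N.integrable_const_bound[where B=1])
      (use that PQ in \<open>auto simp: abs_mult intro!: mult_le_one\<close>)
  \<comment> \<open>The weight \<open>P (1 + cos (c + L))\<close> is nonnegative, and by the product formula for cosines
    its Fourier transform along \<open>X u\<close> is a combination of integrals given by the induction
    hypothesis.  Sines are cosines with the phase shifted by a quarter turn.\<close>
  have wt: "(LINT x|M. P x * (1 + cos (c + L a x)) * cos (d + \<xi> * X u x)) =
      (LINT x|N. Q x * (1 + cos (c + K a x)) * cos (d + \<xi> * Z u x))" for c a d \<xi>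
  proof -
    have e: "p * (1 + cos (c + l)) * cos (d + \<xi> * y) =
       p * cos (d + \<xi> * y) + (1/2) * (p * cos ((c + d) + (l + \<xi> * y))) + (1/2) * (p * cos ((c - d) + (l + (- \<xi>) * y)))"
      for p l y :: real
      by (simp add: algebra_simps cos_times_cos add_divide_distrib diff_divide_distrib)
    have z: "L ((\<lambda>_. 0)(u := \<xi>)) x = \<xi> * X u x" "K ((\<lambda>_. 0)(u := \<xi>)) y = \<xi> * Z u y" for x y
      using upd[of "\<lambda>_. 0" \<xi>] by (simp_all add: L_def K_def)
    have "(LINT x|M. P x * (1 + cos (c + L a x)) * cos (d + \<xi> * X u x)) =
      (LINT x|M. P x * cos (d + \<xi> * X u x)) + (1/2) * (LINT x|M. P x * cos ((c + d) + (L a x + \<xi> * X u x)))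
       + (1/2) * (LINT x|M. P x * cos ((c - d) + (L a x + (- \<xi>) * X u x)))"
      unfolding e
      by (subst Bochner_Integration.integral_add Bochner_Integration.integral_mult_right_zero;
          (intro Bochner_Integration.integrable_add integrable_mult_right iM)?; measurable)+
    also have "\<dots> = (LINT x|N. Q x * cos (d + \<xi> * Z u x)) + (1/2) * (LINT x|N. Q x * cos ((c + d) + (K a x + \<xi> * Z u x)))
       + (1/2) * (LINT x|N. Q x * cos ((c - d) + (K a x + (- \<xi>) * Z u x)))"
      using IH[of d "(\<lambda>_. 0)(u := \<xi>)"] IH[of "c + d" "a(u := a u + \<xi>)"]
        IH[of "c - d" "a(u := a u + - \<xi>)"] unfolding upd z by simp
    also have "\<dots> = (LINT x|N. Q x * (1 + cos (c + K a x)) * cos (d + \<xi> * Z u x))"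
      unfolding e
      by (subst Bochner_Integration.integral_add Bochner_Integration.integral_mult_right_zero;
          (intro Bochner_Integration.integrable_add integrable_mult_right iN)?; measurable)+
    finally show ?thesis .
  qed
  have shift: "cos (- (pi / 2) + y) = sin y" for y :: real
    by (simp add: cos_diff)
  have E: "(LINT x|M. indicator (A u) (X u x) * (P x * (1 + cos (c + L a x)))) =
      (LINT x|N. indicator (A u) (Z u x) * (Q x * (1 + cos (c + K a x))))" for c a
  proof (rule weighted_law_unique[OF M N, where C=2])
    fix \<xi>
    show "(LINT x|M. P x * (1 + cos (c + L a x)) * cos (\<xi> * X u x)) =
         (LINT x|N. Q x * (1 + cos (c + K a x)) * cos (\<xi> * Z u x))"
      using wt[of c a 0 \<xi>] by simp
    show "(LINT x|M. P x * (1 + cos (c + L a x)) * sin (\<xi> * X u x)) =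
         (LINT x|N. Q x * (1 + cos (c + K a x)) * sin (\<xi> * Z u x))"
      using wt[of c a "- (pi / 2)" \<xi>] unfolding shift .
  next
    fix x y
    have "0 \<le> 1 + cos z" "1 + cos z \<le> 2" for z :: real
      using cos_ge_minus_one[of z] cos_le_one[of z] by linarith+
    note b = this
    show "0 \<le> P x * (1 + cos (c + L a x))" "0 \<le> Q y * (1 + cos (c + K a y))"
      using PQ b by auto
    show "P x * (1 + cos (c + L a x)) \<le> 2" "Q y * (1 + cos (c + K a y)) \<le> 2"
      using mult_mono[OF PQ(2) b(2)] mult_mono[OF PQ(4) b(2)] b by auto
  qed measurable
  have iM': "integrable M (\<lambda>x. indicator (A u) (X u x) * (P x * cos (f x)))" if "f \<in> borel_measurable M" for f
    by (rule M.integrable_const_bound[where B=1])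
      (use that PQ in \<open>auto simp: abs_mult indicator_def intro!: mult_le_one\<close>)
  have iN': "integrable N (\<lambda>x. indicator (A u) (Z u x) * (Q x * cos (f x)))" if "f \<in> borel_measurable N" for f
    by (rule N.integrable_const_bound[where B=1])
      (use that PQ in \<open>auto simp: abs_mult indicator_def intro!: mult_le_one\<close>)
  have split: "(LINT x|M. indicator (A u) (X u x) * (P x * (1 + cos (c + L a x)))) =
      (LINT x|M. indicator (A u) (X u x) * P x) + (LINT x|M. indicator (A u) (X u x) * (P x * cos (c + L a x)))"
     "(LINT x|N. indicator (A u) (Z u x) * (Q x * (1 + cos (c + K a x)))) =
      (LINT x|N. indicator (A u) (Z u x) * Q x) + (LINT x|N. indicator (A u) (Z u x) * (Q x * cos (c + K a x)))" for c a
    using iM'[of "\<lambda>_. 0"] iM'[of "\<lambda>x. c + L a x"] iN'[of "\<lambda>_. 0"] iN'[of "\<lambda>x. c + K a x"]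
    by (simp_all add: distrib_left)
  have "L (\<lambda>_. 0) x = 0" "K (\<lambda>_. 0) y = 0" for x y by (simp_all add: L_def K_def)
  then have "(LINT x|M. indicator (A u) (X u x) * P x) = (LINT x|N. indicator (A u) (Z u x) * Q x)"
    using E[of 0 "\<lambda>_. 0"] by (simp add: mult.assoc[symmetric])
  then have "(LINT x|M. indicator (A u) (X u x) * (P x * cos (c + L a x))) =
       (LINT x|N. indicator (A u) (Z u x) * (Q x * cos (c + K a x)))"
    using E[of c a] split by simp
  then show ?case
    using insert(1,2) by (simp add: P_def Q_def L_def K_def mult.assoc)
qed

text \<open>
  With zero frequencies the preceding lemma says that the two processes give the same probability
  to every rectangle in finitely many coordinates, and these rectangles generate the product
  sigma-algebra.
\<close>

theorem gaussian_process_law_unique: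
  fixes X :: "'t \<Rightarrow> 'a \<Rightarrow> real" and Z :: "'t \<Rightarrow> 'b \<Rightarrow> real"
  assumes X: "centered_gaussian_process M T X" and Z: "centered_gaussian_process N T Z"
    and cov: "\<And>s t. \<lbrakk>s \<in> T; t \<in> T\<rbrakk> \<Longrightarrow> cov_fun M X s t = cov_fun N Z s t"
  shows "process_law M T X = process_law N T Z"
proof -
  have M: "prob_space M" and N: "prob_space N"
    using X Z by (auto simp: centered_gaussian_process_def)
  have meas: "(\<lambda>x. \<lambda>t\<in>T. X t x) \<in> measurable M (\<Pi>\<^sub>M t\<in>T. borel)" 
    if "centered_gaussian_process M T X" for M :: "'c measure" and X :: "'t \<Rightarrow> 'c \<Rightarrow> real"
    using gaussian_process_measurable[OF that] by (intro measurable_restrict)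
  have rect: "emeasure (process_law M T X) (prod_emb T (\<lambda>_. borel) J (Pi\<^sub>E J A)) =
      ennreal (LINT x|M. (\<Prod>t\<in>J. indicator (A t) (X t x)))"
    if X: "centered_gaussian_process M T X" and J: "finite J" "J \<subseteq> T" and A: "\<And>t. t \<in> J \<Longrightarrow> A t \<in> sets borel"
    for M :: "'c measure" and X :: "'t \<Rightarrow> 'c \<Rightarrow> real" and J and A :: "'t \<Rightarrow> real set"
  proof -
    interpret prob_space M using X by (simp add: centered_gaussian_process_def)
    have "emeasure (process_law M T X) (prod_emb T (\<lambda>_. borel) J (Pi\<^sub>E J A)) =
        emeasure M ((\<lambda>x. \<lambda>t\<in>T. X t x) -` prod_emb T (\<lambda>_. borel) J (Pi\<^sub>E J A) \<inter> space M)"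
      unfolding process_law_def
      by (rule emeasure_distr[OF meas[OF X]]) (use J A in \<open>auto intro!: sets_PiM_I\<close>)
    also have "(\<lambda>x. \<lambda>t\<in>T. X t x) -` prod_emb T (\<lambda>_. borel) J (Pi\<^sub>E J A) \<inter> space M =
        {x\<in>space M. \<forall>t\<in>J. X t x \<in> A t}"
      using J by (auto simp: prod_emb_def PiE_iff Pi_iff subset_iff)
    also have "emeasure M \<dots> = ennreal (LINT x|M. indicator {x\<in>space M. \<forall>t\<in>J. X t x \<in> A t} x)"
      by (simp add: emeasure_eq_measure Int_absorb2)
    also have "(LINT x|M. indicator {x\<in>space M. \<forall>t\<in>J. X t x \<in> A t} x) =
        (LINT x|M. (\<Prod>t\<in>J. indicator (A t) (X t x)) :: real)"
      using J(1) by (intro Bochner_Integration.integral_cong refl) (auto simp: indicator_def)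
    finally show ?thesis .
  qed
  show ?thesis
  proof (rule measure_eqI_PiM_infinite[where I=T and M="\<lambda>_. borel"])
    show "sets (process_law M T X) = sets (\<Pi>\<^sub>M t\<in>T. borel)" "sets (process_law N T Z) = sets (\<Pi>\<^sub>M t\<in>T. borel)"
      by (simp_all add: process_law_def)
    show "finite_measure (process_law M T X)"
      unfolding process_law_def
      by (intro prob_space.finite_measure prob_space.prob_space_distr M meas[OF X])
    fix A :: "'t \<Rightarrow> real set" and J
    assume J: "finite J" "J \<subseteq> T" and A: "\<And>t. t \<in> J \<Longrightarrow> A t \<in> sets borel"
    define A' where "A' t = (if t \<in> J then A t else {})" for t
    have "(LINT x|M. (\<Prod>t\<in>J. indicator (A' t) (X t x)) :: real) = (LINT x|N. (\<Prod>t\<in>J. indicator (A' t) (Z t x)))"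
      using gaussian_rectangle_cos_eq[OF X Z cov J J(1) order_refl, of A' 0 "\<lambda>_. 0"] A
      by (simp add: A'_def)
    then have "(LINT x|M. (\<Prod>t\<in>J. indicator (A t) (X t x)) :: real) = (LINT x|N. (\<Prod>t\<in>J. indicator (A t) (Z t x)))"
      by (simp add: A'_def cong: prod.cong)
    then show "emeasure (process_law M T X) (prod_emb T (\<lambda>_. borel) J (Pi\<^sub>E J A)) =
        emeasure (process_law N T Z) (prod_emb T (\<lambda>_. borel) J (Pi\<^sub>E J A))"
      using rect[OF X J, of A] rect[OF Z J, of A] A by simp
  qed
qed

section \<open>Mean-square convergent Gaussian series\<close>

lemma iid_std_normal_sum:
  assumes \<omega>: "iid_std_normal N K \<omega>" and F: "finite F" "F \<subseteq> K"
  shows "centered_normal N (\<lambda>x. \<Sum>k\<in>F. b k * \<omega> k x)"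
    and "(LINT x|N. (\<Sum>k\<in>F. b k * \<omega> k x)\<^sup>2) = (\<Sum>k\<in>F. (b k)\<^sup>2)"
proof -
  interpret prob_space N using \<omega> by (simp add: iid_std_normal_def)
  have D: "distributed N lborel (\<omega> k) (\<lambda>x. ennreal (std_normal_density x))" if "k \<in> F" for k
    using \<omega> F that by (auto simp: iid_std_normal_def)
  have m: "\<omega> k \<in> borel_measurable N" if "k \<in> F" for k
    using distributed_measurable[OF D[OF that]] by simp
  have "indep_vars (\<lambda>_. borel) \<omega> F"
    using \<omega> F by (auto simp: iid_std_normal_def intro: indep_vars_subset)
  then have ind: "indep_vars (\<lambda>_. borel) (\<lambda>k x. b k * \<omega> k x) F"
    by (rule indep_vars_compose2[where Y="\<lambda>k x. b k * x"]) simp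
  have ch: "char (distr N borel (\<lambda>x. b k * \<omega> k x)) t = exp (- (b k)\<^sup>2 * t\<^sup>2 / 2)" if k: "k \<in> F" for k t
  proof -
    have "distr N borel (\<omega> k) = std_normal_distribution"
      using distributed_distr_eq_density[OF D[OF k]] by (simp cong: distr_cong)
    then have "char std_normal_distribution (t * b k) = (CLINT x|N. iexp (t * b k * \<omega> k x))"
      using char_distr[OF m[OF k], of "t * b k"] by simp
    also have "\<dots> = char (distr N borel (\<lambda>x. b k * \<omega> k x)) t"
      using m[OF k] by (simp add: char_distr mult.assoc)
    finally show ?thesis
      by (simp add: char_std_normal_distribution power_mult_distrib mult.commute)
  qed
  have "char (distr N borel (\<lambda>x. \<Sum>k\<in>F. b k * \<omega> k x)) t =
      complex_of_real (exp (- (\<Sum>k\<in>F. (b k)\<^sup>2) * t\<^sup>2 / 2))" for t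
    unfolding char_distr_sum[OF ind] using F(1)
    by (simp add: ch exp_sum[symmetric] sum_distrib_right sum_negf sum_divide_distrib flip: of_real_prod)
  note * = this
  have m': "(\<lambda>x. \<Sum>k\<in>F. b k * \<omega> k x) \<in> borel_measurable N"
    using m by (intro borel_measurable_sum borel_measurable_times) auto
  have "0 \<le> (\<Sum>k\<in>F. (b k)\<^sup>2)" by (simp add: sum_nonneg)
  note centered_normalI_char[OF prob_space_axioms m' this *]
  then show "centered_normal N (\<lambda>x. \<Sum>k\<in>F. b k * \<omega> k x)"
    "(LINT x|N. (\<Sum>k\<in>F. b k * \<omega> k x)\<^sup>2) = (\<Sum>k\<in>F. (b k)\<^sup>2)" .
qed

lemma infsum_tail_tendsto_0:
  fixes m :: "'k \<Rightarrow> real"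
  assumes "m summable_on K"
  shows "((\<lambda>F. infsum m (K - F)) \<longlongrightarrow> 0) (finite_subsets_at_top K)"
proof -
  have "((\<lambda>F. infsum m K - sum m F) \<longlongrightarrow> infsum m K - infsum m K) (finite_subsets_at_top K)"
    by (intro tendsto_intros infsum_tendsto assms)
  moreover have "\<forall>\<^sub>F F in finite_subsets_at_top K. infsum m K - sum m F = infsum m (K - F)"
    by (rule eventually_finite_subsets_at_top_weakI)
      (use assms in \<open>simp add: infsum_Diff summable_on_finite\<close>)
  ultimately show ?thesis by (simp add: tendsto_cong)
qed

text \<open>
  The tail of \<open>m\<close> bounds the mean-square distance between partial sums at all points \<open>t\<close>
  simultaneously.  Hence one sequence of finite index sets can be chosen along which the partial
  sums converge almost surely at every \<open>t\<close>.  The limit \<open>Z\<close> is then an almost sure limit of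
  Gaussian processes, and Fatou's lemma transfers the mean-square estimate to the whole net of
  finite partial sums.
\<close>

theorem gaussian_series:
  fixes a :: "'k \<Rightarrow> 't \<Rightarrow> real"
  assumes \<omega>: "iid_std_normal N K \<omega>"
    and bound: "\<And>k t. \<lbrakk>k \<in> K; t \<in> T\<rbrakk> \<Longrightarrow> (a k t)\<^sup>2 \<le> m k"
    and summ: "m summable_on K"
  obtains Z where "\<And>t. t \<in> T \<Longrightarrow> mean_square_sums N K (\<lambda>k x. \<omega> k x * a k t) (Z t)"
    and "centered_gaussian_process N T Z"
    and "\<And>s t. \<lbrakk>s \<in> T; t \<in> T\<rbrakk> \<Longrightarrow> cov_fun N Z s t = infsum (\<lambda>k. a k s * a k t) K"
proof (cases "T = {}")
  case True
  have "prob_space N" using \<omega> by (simp add: iid_std_normal_def)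
  moreover have "centered_normal N (\<lambda>x. 0)" by (simp add: centered_normal_def)
  ultimately show ?thesis
    using True by (intro that) (auto simp: centered_gaussian_process_def)
next
  case False
  interpret prob_space N using \<omega> by (simp add: iid_std_normal_def)
  have mpos: "0 \<le> m k" if "k \<in> K" for k
    using False bound[OF that] by (meson all_not_in_conv order_trans zero_le_power2)
  have m\<omega>: "\<omega> k \<in> borel_measurable N" if "k \<in> K" for k
    using \<omega> distributed_measurable[of N lborel "\<omega> k"] that by (auto simp: iid_std_normal_def)
  define S where "S F t x = (\<Sum>k\<in>F. a k t * \<omega> k x)" for F t x
  define \<tau> where "\<tau> F = infsum m (K - F)" for F
  have summK: "m summable_on K - F" for F
    using summ by (rule summable_on_subset_banach) auto
  have tail: "(\<Sum>k\<in>G. m k) \<le> \<tau> F" if "finite G" "G \<subseteq> K - F" for F G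
    unfolding \<tau>_def by (rule finite_sum_le_infsum) (use that mpos summK in auto)
  have \<tau>0: "(\<tau> \<longlongrightarrow> 0) (finite_subsets_at_top K)"
    unfolding \<tau>_def by (rule infsum_tail_tendsto_0[OF summ])
  have [measurable]: "S F t \<in> borel_measurable N" if "F \<subseteq> K" for F t
    unfolding S_def using that m\<omega> by (intro borel_measurable_sum borel_measurable_times) auto
  have dist: "integrable N (\<lambda>x. (S F t x - S G t x)\<^sup>2) \<and> (LINT x|N. (S F t x - S G t x)\<^sup>2) \<le> \<tau> F + \<tau> G"
    if F: "finite F" "F \<subseteq> K" and G: "finite G" "G \<subseteq> K" and t: "t \<in> T" for F G t
  proof -
    define b where "b k = a k t * (indicator F k - indicator G k)" for k
    have eq: "S F t x - S G t x = (\<Sum>k\<in>F \<union> G. b k * \<omega> k x)" for x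
    proof -
      have "S H t x = (\<Sum>k\<in>F \<union> G. indicator H k * (a k t * \<omega> k x))" if "H = F \<or> H = G" for H
        unfolding S_def using F G that
        by (intro sum.mono_neutral_cong_left) (auto simp: indicator_def)
      from this[of F] this[of G] show ?thesis
        by (simp add: b_def algebra_simps sum_subtractf)
    qed
    have FG: "finite (F \<union> G)" "F \<union> G \<subseteq> K" using F G by auto
    have "(\<Sum>k\<in>F \<union> G. (b k)\<^sup>2) = (\<Sum>k\<in>(F - G) \<union> (G - F). (b k)\<^sup>2)"
      using F G by (intro sum.mono_neutral_right) (auto simp: b_def indicator_def)
    also have "\<dots> = (\<Sum>k\<in>F - G. (b k)\<^sup>2) + (\<Sum>k\<in>G - F. (b k)\<^sup>2)"
      using F G by (intro sum.union_disjoint) auto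
    also have "\<dots> \<le> (\<Sum>k\<in>F - G. m k) + (\<Sum>k\<in>G - F. m k)"
      using F G bound t by (intro add_mono sum_mono) (auto simp: b_def indicator_def)
    also have "\<dots> \<le> \<tau> G + \<tau> F"
      using F G by (intro add_mono tail) auto
    finally show ?thesis
      unfolding eq iid_std_normal_sum(2)[OF \<omega> FG]
      using centered_normal_second_moment_char(1)[OF prob_space_axioms iid_std_normal_sum(1)[OF \<omega> FG]]
      by simp
  qed
  \<comment> \<open>Tails of size \<open>4\<close> to the \<open>- j\<close> make consecutive partial sums differ by the order of \<open>2\<close> to
    the \<open>- j\<close> in \<open>L\<^sup>1\<close>, which is summable.\<close>
  have "\<exists>F. finite F \<and> F \<subseteq> K \<and> \<tau> F < (1/4) ^ j" for j :: nat
  proof -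
    have "\<forall>\<^sub>F F in finite_subsets_at_top K. \<tau> F < (1/4) ^ j"
      by (rule order_tendstoD(2)[OF \<tau>0]) simp
    moreover have "\<forall>\<^sub>F F in finite_subsets_at_top K. finite F \<and> F \<subseteq> K"
      by (rule eventually_finite_subsets_at_top_weakI) auto
    ultimately have "\<forall>\<^sub>F F in finite_subsets_at_top K. finite F \<and> F \<subseteq> K \<and> \<tau> F < (1/4) ^ j"
      by eventually_elim auto
    then show ?thesis
      using eventually_happens' finite_subsets_at_top_neq_bot by blast
  qed
  then obtain E where E: "\<And>j. finite (E j)" "\<And>j. E j \<subseteq> K" "\<And>j::nat. \<tau> (E j) < (1/4) ^ j"
    by metis
  have [measurable]: "S (E j) t \<in> borel_measurable N" for j t by (simp add: E)
  define Z where "Z t x = lim (\<lambda>j. S (E j) t x)" for t x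
  have mZ[measurable]: "Z t \<in> borel_measurable N" for t
    unfolding Z_def by (rule borel_measurable_lim_metric) simp
  have lim: "AE x in N. (\<lambda>j. S (E j) t x) \<longlonglongrightarrow> Z t x" if t: "t \<in> T" for t
  proof -
    define D where "D j x = S (E (Suc j)) t x - S (E j) t x" for j x
    have [measurable]: "D j \<in> borel_measurable N" for j unfolding D_def by simp
    have D: "(\<integral>\<^sup>+x. ennreal \<bar>D j x\<bar> \<partial>N) \<le> ennreal (3 * (1/2) ^ j)" for j
    proof -
      have i: "integrable N (\<lambda>x. (D j x)\<^sup>2)" and le: "(LINT x|N. (D j x)\<^sup>2) \<le> 2 * (1/4) ^ j"
      proof -
        have "(1/4::real) ^ Suc j \<le> (1/4) ^ j" by (intro power_decreasing) auto
        with E(3)[of "Suc j"] have "\<tau> (E (Suc j)) < (1/4) ^ j" by (rule order.strict_trans2)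
        then show "integrable N (\<lambda>x. (D j x)\<^sup>2)" "(LINT x|N. (D j x)\<^sup>2) \<le> 2 * (1/4) ^ j"
          using dist[OF E(1,2) E(1,2) t, of "Suc j" j] E(3)[of j]
          unfolding D_def by auto
      qed
      have le1: "\<bar>d\<bar> \<le> (1/2) ^ j + 2 ^ j * d\<^sup>2" for d :: real
      proof (cases "\<bar>d\<bar> \<le> (1/2) ^ j")
        case False
        then have "1 \<le> 2 ^ j * \<bar>d\<bar>" by (simp add: field_simps power_divide)
        then have "1 * \<bar>d\<bar> \<le> 2 ^ j * \<bar>d\<bar> * \<bar>d\<bar>" by (intro mult_right_mono) auto
        moreover have "0 \<le> (1/2::real) ^ j" by simp
        moreover have "2 ^ j * \<bar>d\<bar> * \<bar>d\<bar> = 2 ^ j * d\<^sup>2"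
          by (simp add: power2_eq_square mult.assoc)
        ultimately show ?thesis by linarith
      qed (simp add: add_increasing2)
      have "(\<integral>\<^sup>+x. ennreal \<bar>D j x\<bar> \<partial>N) \<le> (\<integral>\<^sup>+x. ennreal ((1/2) ^ j + 2 ^ j * (D j x)\<^sup>2) \<partial>N)"
        by (intro nn_integral_mono ennreal_leI le1)
      also have "\<dots> = ennreal (LINT x|N. (1/2) ^ j + 2 ^ j * (D j x)\<^sup>2)"
        using i by (intro nn_integral_eq_integral) (auto intro!: AE_I2 add_nonneg_nonneg)
      also have "(LINT x|N. (1/2) ^ j + 2 ^ j * (D j x)\<^sup>2) = (1/2) ^ j + 2 ^ j * (LINT x|N. (D j x)\<^sup>2)"
        using i by (simp add: prob_space)
      also have "\<dots> \<le> (1/2) ^ j + 2 ^ j * (2 * (1/4) ^ j)"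
        using le by (intro add_left_mono mult_left_mono) auto
      also have "2 ^ j * (2 * (1/4) ^ j) = 2 * (1/2 :: real) ^ j"
      proof -
        have "(2::real) ^ j * (1/4) ^ j = (1/2) ^ j" by (simp flip: power_mult_distrib)
        then show ?thesis by simp
      qed
      finally show ?thesis by (simp add: ennreal_leI)
    qed
    have "(\<integral>\<^sup>+x. (\<Sum>j. ennreal \<bar>D j x\<bar>) \<partial>N) = (\<Sum>j. \<integral>\<^sup>+x. ennreal \<bar>D j x\<bar> \<partial>N)"
      by (rule nn_integral_suminf) simp
    also have "\<dots> \<le> (\<Sum>j. ennreal (3 * (1/2) ^ j))"
      by (intro suminf_le D) auto
    also have "\<dots> = ennreal (\<Sum>j. 3 * (1/2) ^ j)"
      by (rule suminf_ennreal2) (auto intro!: summable_mult summable_geometric)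
    also have "\<dots> < \<infinity>" by simp
    finally have "AE x in N. (\<Sum>j. ennreal \<bar>D j x\<bar>) \<noteq> \<infinity>"
      by (intro nn_integral_noteq_infinite) auto
    then show ?thesis
    proof eventually_elim
      case (elim x)
      then have "summable (\<lambda>j. \<bar>D j x\<bar>)"
        by (intro summable_suminf_not_top) auto
      then have "summable (\<lambda>j. D j x)" by (rule summable_rabs_cancel)
      then obtain l where "(\<lambda>n. \<Sum>j<n. D j x) \<longlonglongrightarrow> l"
        by (auto simp: summable_def sums_def)
      then have "(\<lambda>n. (\<Sum>j<n. D j x) + S (E 0) t x) \<longlonglongrightarrow> l + S (E 0) t x"
        by (intro tendsto_intros)
      then have "(\<lambda>n. S (E n) t x) \<longlonglongrightarrow> l + S (E 0) t x"
        unfolding D_def sum_lessThan_telescope[of "\<lambda>j. S (E j) t x"] by simp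
      then show ?case unfolding Z_def by (metis limI)
    qed
  qed
  show ?thesis
  proof (rule that)
    fix t assume t: "t \<in> T"
    have fatou: "(\<integral>\<^sup>+x. ennreal ((Z t x - S F t x)\<^sup>2) \<partial>N) \<le> ennreal (\<tau> F)"
      if F: "finite F" "F \<subseteq> K" for F
    proof -
      have [measurable]: "S F t \<in> borel_measurable N" using F by simp
      have "(\<integral>\<^sup>+x. ennreal ((Z t x - S F t x)\<^sup>2) \<partial>N) =
          (\<integral>\<^sup>+x. liminf (\<lambda>j. ennreal ((S (E j) t x - S F t x)\<^sup>2)) \<partial>N)"
      proof (rule nn_integral_cong_AE)
        show "AE x in N. ennreal ((Z t x - S F t x)\<^sup>2) = liminf (\<lambda>j. ennreal ((S (E j) t x - S F t x)\<^sup>2))"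
          using lim[OF t]
          by eventually_elim
            (rule lim_imp_Liminf[symmetric], simp, intro tendsto_intros, assumption)
      qed
      also have "\<dots> \<le> liminf (\<lambda>j. \<integral>\<^sup>+x. ennreal ((S (E j) t x - S F t x)\<^sup>2) \<partial>N)"
        by (rule nn_integral_liminf) simp
      also have "\<dots> \<le> liminf (\<lambda>j. ennreal ((1/4) ^ j + \<tau> F))"
      proof (intro Liminf_mono always_eventually allI)
        fix j
        have "(\<integral>\<^sup>+x. ennreal ((S (E j) t x - S F t x)\<^sup>2) \<partial>N) = ennreal (LINT x|N. (S (E j) t x - S F t x)\<^sup>2)"
          using dist[OF E(1,2) F t] by (intro nn_integral_eq_integral) auto
        also have "\<dots> \<le> ennreal ((1/4) ^ j + \<tau> F)"
          using dist[OF E(1,2) F t, of j] E(3)[of j] by (intro ennreal_leI) auto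
        finally show "(\<integral>\<^sup>+x. ennreal ((S (E j) t x - S F t x)\<^sup>2) \<partial>N) \<le> ennreal ((1/4) ^ j + \<tau> F)" .
      qed
      also have "liminf (\<lambda>j. ennreal ((1/4) ^ j + \<tau> F)) = ennreal (0 + \<tau> F)"
        by (intro lim_imp_Liminf tendsto_ennrealI tendsto_intros LIMSEQ_realpow_zero) auto
      finally show ?thesis by simp
    qed
    have "((\<lambda>F. \<integral>\<^sup>+x. ennreal ((Z t x - S F t x)\<^sup>2) \<partial>N) \<longlongrightarrow> 0) (finite_subsets_at_top K)"
    proof (rule tendsto_sandwich[OF _ _ tendsto_const])
      show "\<forall>\<^sub>F F in finite_subsets_at_top K. (\<integral>\<^sup>+x. ennreal ((Z t x - S F t x)\<^sup>2) \<partial>N) \<le> ennreal (\<tau> F)"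
        by (rule eventually_finite_subsets_at_top_weakI) (rule fatou)
      show "((\<lambda>F. ennreal (\<tau> F)) \<longlongrightarrow> 0) (finite_subsets_at_top K)"
        using tendsto_ennrealI[OF \<tau>0] by simp
    qed simp
    then show "mean_square_sums N K (\<lambda>k x. \<omega> k x * a k t) (Z t)"
      using m\<omega> by (simp add: mean_square_sums_def S_def mult.commute)
  next
    have G: "centered_gaussian_process N T (S (E j))" for j
      unfolding centered_gaussian_process_def
    proof (intro conjI prob_space_axioms allI impI)
      fix G :: "'t set" and c
      have "(\<Sum>t\<in>G. c t * S (E j) t x) = (\<Sum>k\<in>E j. (\<Sum>t\<in>G. c t * a k t) * \<omega> k x)" for x
        unfolding S_def sum_distrib_left sum_distrib_right
        by (subst sum.swap) (simp add: mult.assoc)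
      then show "centered_normal N (\<lambda>x. \<Sum>t\<in>G. c t * S (E j) t x)"
        using iid_std_normal_sum(1)[OF \<omega> E(1,2)] by simp
    qed
    show Z: "centered_gaussian_process N T Z"
      by (rule gaussian_process_AE_limit(1)[OF G]) (use lim in auto)
    fix s t assume st: "s \<in> T" "t \<in> T"
    have conv: "(\<lambda>j. cov_fun N (S (E j)) s t) \<longlonglongrightarrow> cov_fun N Z s t"
      by (rule gaussian_process_AE_limit(2)[OF G]) (use lim st in auto)
    have cov: "cov_fun N (S (E j)) s t = (\<Sum>k\<in>E j. a k s * a k t)" for j
    proof -
      have "(LINT x|N. (c * S (E j) s x + d * S (E j) t x)\<^sup>2) = (\<Sum>k\<in>E j. (c * a k s + d * a k t)\<^sup>2)" for c d
        using iid_std_normal_sum(2)[OF \<omega> E(1,2)[of j], of "\<lambda>k. c * a k s + d * a k t"]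
        by (simp add: S_def sum_distrib_left algebra_simps sum.distrib)
      then have "cov_fun N (S (E j)) s t =
          ((\<Sum>k\<in>E j. (1 * a k s + 1 * a k t)\<^sup>2) - (\<Sum>k\<in>E j. (1 * a k s + (- 1) * a k t)\<^sup>2)) / 4"
        unfolding cov_fun_polarization[OF G st] by presburger
      also have "\<dots> = (\<Sum>k\<in>E j. ((1 * a k s + 1 * a k t)\<^sup>2 - (1 * a k s + (- 1) * a k t)\<^sup>2) / 4)"
        by (simp only: sum_subtractf[symmetric] sum_divide_distrib)
      also have "\<dots> = (\<Sum>k\<in>E j. a k s * a k t)"
        by (intro sum.cong refl) (simp add: power2_eq_square algebra_simps)
      finally show ?thesis .
    qed
    have le: "norm (a k s * a k t) \<le> m k" if "k \<in> K" for k
    proof -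
      have "2 * \<bar>a k s\<bar> * \<bar>a k t\<bar> \<le> \<bar>a k s\<bar>\<^sup>2 + \<bar>a k t\<bar>\<^sup>2" by (rule sum_squares_bound)
      then show ?thesis
        using bound[OF that st(1)] bound[OF that st(2)] by (simp add: abs_mult)
    qed
    have sm: "(\<lambda>k. a k s * a k t) summable_on K"
      by (rule abs_summable_summable[OF Infinite_Sum.abs_summable_on_comparison_test'[OF summ le]])
    have diff: "norm ((\<Sum>k\<in>E j. a k s * a k t) - infsum (\<lambda>k. a k s * a k t) K) \<le> (1/4) ^ j" for j
    proof -
      have "infsum (\<lambda>k. a k s * a k t) (K - E j) = infsum (\<lambda>k. a k s * a k t) K - (\<Sum>k\<in>E j. a k s * a k t)"
        using sm E by (simp add: infsum_Diff summable_on_finite)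
      moreover have "norm (infsum (\<lambda>k. a k s * a k t) (K - E j)) \<le> \<tau> (E j)"
        unfolding \<tau>_def
        by (rule norm_infsum_le[OF has_sum_infsum has_sum_infsum])
          (use le summK summable_on_subset_banach[OF sm] in auto)
      ultimately show ?thesis using E(3)[of j] by (simp add: norm_minus_commute)
    qed
    have "(\<lambda>j. (\<Sum>k\<in>E j. a k s * a k t) - infsum (\<lambda>k. a k s * a k t) K) \<longlonglongrightarrow> 0"
      by (rule Lim_null_comparison[OF always_eventually LIMSEQ_realpow_zero]) (use diff in auto)
    then have "(\<lambda>j. \<Sum>k\<in>E j. a k s * a k t) \<longlonglongrightarrow> infsum (\<lambda>k. a k s * a k t) K"
      by (simp add: LIM_zero_iff)
    with conv show "cov_fun N Z s t = infsum (\<lambda>k. a k s * a k t) K"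
      unfolding cov by (rule LIMSEQ_unique)
  qed
qed

section \<open>Cosine expansion of the one-dimensional covariance\<close>

lemma integral_cos_nat_pi:
  "((\<lambda>u. cos (real n * pi * u)) has_integral (if n = 0 then 1 else 0)) {0..1}"
proof (cases "n = 0")
  case True
  then show ?thesis using has_integral_const_real[of "1::real" 0 1] by simp
next
  case False
  have "((\<lambda>u. cos (real n * pi * u)) has_integral
      sin (real n * pi * 1) / (real n * pi) - sin (real n * pi * 0) / (real n * pi)) {0..1}"
    using False
    by (intro fundamental_theorem_of_calculus)
      (auto intro!: derivative_eq_intros simp flip: has_real_derivative_iff_has_vector_derivative)
  then show ?thesis using False by simp
qed

lemma integral_cos_cos_nat_pi:
  "((\<lambda>u. cos (real k * pi * u) * cos (real l * pi * u)) has_integral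
     (if k = l then if k = 0 then 1 else 1 / 2 else 0)) {0..1}"
proof -
  have le: "((\<lambda>u. cos (real k * pi * u) * cos (real l * pi * u)) has_integral
     (if k = l then if k = 0 then 1 else 1 / 2 else 0)) {0..1}" if "l \<le> k" for k l
  proof -
    have e: "cos (real k * pi * u) * cos (real l * pi * u) =
        (cos (real (k - l) * pi * u) + cos (real (k + l) * pi * u)) / 2" for u
      unfolding cos_times_cos using that by (simp add: of_nat_diff algebra_simps)
    have "((\<lambda>u. (cos (real (k - l) * pi * u) + cos (real (k + l) * pi * u)) / 2) has_integral
        ((if k - l = 0 then 1 else 0) + (if k + l = 0 then 1 else 0)) / 2) {0..1}"
      by (intro has_integral_divide has_integral_add integral_cos_nat_pi)
    moreover have "((if k - l = 0 then 1 else 0) + (if k + l = 0 then 1 else 0)) / 2 =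
        (if k = l then if k = 0 then 1 else 1 / 2 else (0::real))"
      using that by auto
    ultimately show ?thesis by (simp only: e)
  qed
  show ?thesis
    using le[of l k] le[of k l] by (cases "l \<le> k") (auto simp: mult.commute)
qed

text \<open>
  A polynomial in \<open>cos (pi * u)\<close> is a combination of the functions \<open>cos (n * pi * u)\<close>, and
  Weierstrass approximation in the variable \<open>x = cos (pi * u)\<close> makes \<open>f\<close> a uniform limit of
  such polynomials.  Thus \<open>f\<close> is orthogonal to itself.
\<close>

lemma cosine_system_complete:
  fixes f :: "real \<Rightarrow> real"
  assumes f: "continuous_on {0..1} f"
    and orth: "\<And>n. integral {0..1} (\<lambda>u. f u * cos (real n * pi * u)) = 0"
    and u: "u \<in> {0..1}"
  shows "f u = 0"
proof -
  have int: "(\<lambda>u. f u * g u) integrable_on {0..1}" if "continuous_on {0..1} g" for g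
    by (intro integrable_continuous_real continuous_on_mult f that)
  have pow: "integral {0..1} (\<lambda>u. f u * (cos (real n * pi * u) * cos (pi * u) ^ m)) = 0" for n m
  proof (induction m arbitrary: n)
    case 0
    then show ?case using orth by simp
  next
    case (Suc m)
    show ?case
    proof (cases n)
      case 0
      then show ?thesis using Suc[of 1] by simp
    next
      case n: (Suc n')
      have "cos (real n * pi * u) * cos (pi * u) ^ Suc m =
         (1/2) * (cos (real n' * pi * u) * cos (pi * u) ^ m) + (1/2) * (cos (real (Suc n) * pi * u) * cos (pi * u) ^ m)" for u
      proof -
        have "cos (real n * pi * u) * cos (pi * u) = (cos (real n' * pi * u) + cos (real (Suc n) * pi * u)) / 2"
          unfolding cos_times_cos n by (simp add: algebra_simps)
        moreover have "a * c ^ Suc m = (1/2) * (p * c ^ m) + (1/2) * (q * c ^ m)"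
          if "a * c = (p + q) / 2" for a c p q :: real
        proof -
          have "a * c ^ Suc m = (a * c) * c ^ m" by simp
          then show ?thesis unfolding that by (simp add: distrib_right add_divide_distrib)
        qed
        ultimately show ?thesis by blast
      qed
      then have "integral {0..1} (\<lambda>u. f u * (cos (real n * pi * u) * cos (pi * u) ^ Suc m)) =
        integral {0..1} (\<lambda>u. (1/2) * (f u * (cos (real n' * pi * u) * cos (pi * u) ^ m)) +
           (1/2) * (f u * (cos (real (Suc n) * pi * u) * cos (pi * u) ^ m)))"
        by (intro Henstock_Kurzweil_Integration.integral_cong) (simp add: algebra_simps)
      also have "\<dots> = (1/2) * integral {0..1} (\<lambda>u. f u * (cos (real n' * pi * u) * cos (pi * u) ^ m)) +
           (1/2) * integral {0..1} (\<lambda>u. f u * (cos (real (Suc n) * pi * u) * cos (pi * u) ^ m))"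
        by (subst Henstock_Kurzweil_Integration.integral_add Henstock_Kurzweil_Integration.integral_mult_right;
            (intro integrable_on_mult_right int continuous_intros)?)+ (rule refl)
      finally show ?thesis using Suc[of n'] Suc[of "Suc n"] by simp
    qed
  qed
  have poly: "integral {0..1} (\<lambda>u. f u * p (cos (pi * u))) = 0" if p: "real_polynomial_function p" for p
  proof -
    obtain a n where "p = (\<lambda>x. \<Sum>i\<le>n. a i * x ^ i)"
      using p unfolding real_polynomial_function_iff_sum by blast
    then have "integral {0..1} (\<lambda>u. f u * p (cos (pi * u))) =
        integral {0..1} (\<lambda>u. \<Sum>i\<le>n. a i * (f u * cos (pi * u) ^ i))"
      by (simp add: sum_distrib_left algebra_simps)
    also have "\<dots> = (\<Sum>i\<le>n. integral {0..1} (\<lambda>u. a i * (f u * cos (pi * u) ^ i)))"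
      by (intro integral_sum integrable_on_mult_right int continuous_intros) auto
    also have "\<dots> = 0"
      using pow[of 0] by simp
    finally show ?thesis .
  qed
  define C where "C = integral {0..1} (\<lambda>u. \<bar>f u\<bar>)"
  have C: "0 \<le> C" unfolding C_def
    by (intro Henstock_Kurzweil_Integration.integral_nonneg integrable_continuous_real continuous_intros f) auto
  have small: "integral {0..1} (\<lambda>u. f u * f u) \<le> e * C" if e: "e > 0" for e
  proof -
    \<comment> \<open>\<open>f\<close> as a function of \<open>x = cos (pi * u)\<close>.\<close>
    have "continuous_on {-1..1} (\<lambda>x. f (arccos x / pi))"
      by (intro continuous_on_compose2[OF f] continuous_intros)
        (auto simp: arccos_lbound arccos_ubound divide_simps)
    then obtain p where p: "real_polynomial_function p" "\<And>x. x \<in> {-1..1} \<Longrightarrow> \<bar>f (arccos x / pi) - p x\<bar> < e"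
      using Stone_Weierstrass_real_polynomial_function[OF compact_Icc _ e] by metis
    have app: "\<bar>f u - p (cos (pi * u))\<bar> \<le> e" if "u \<in> {0..1}" for u
    proof -
      have "arccos (cos (pi * u)) = pi * u"
        using that by (intro arccos_cos) (auto simp: mult_left_le)
      then show ?thesis using p(2)[of "cos (pi * u)"] by simp
    qed
    have cp: "continuous_on {0..1} (\<lambda>u. p (cos (pi * u)))"
      by (rule continuous_on_compose2[of UNIV p])
        (use p(1) in \<open>auto intro!: continuous_intros continuous_at_imp_continuous_on
          simp: continuous_real_polymonial_function\<close>)
    have "integral {0..1} (\<lambda>u. f u * f u) =
        integral {0..1} (\<lambda>u. f u * (f u - p (cos (pi * u))) + f u * p (cos (pi * u)))"
      by (simp add: algebra_simps)
    also have "\<dots> = integral {0..1} (\<lambda>u. f u * (f u - p (cos (pi * u)))) + integral {0..1} (\<lambda>u. f u * p (cos (pi * u)))"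
      by (intro Henstock_Kurzweil_Integration.integral_add int continuous_intros f cp)
    also have "\<dots> = integral {0..1} (\<lambda>u. f u * (f u - p (cos (pi * u))))"
      using poly[OF p(1)] by simp
    also have "\<dots> \<le> integral {0..1} (\<lambda>u. e * \<bar>f u\<bar>)"
    proof (intro integral_le int integrable_continuous_real continuous_intros f cp)
      fix u :: real assume "u \<in> {0..1}"
      then have "\<bar>f u\<bar> * \<bar>f u - p (cos (pi * u))\<bar> \<le> \<bar>f u\<bar> * e"
        by (intro mult_left_mono app) auto
      then show "f u * (f u - p (cos (pi * u))) \<le> e * \<bar>f u\<bar>"
        by (metis abs_ge_self abs_mult mult.commute order_trans)
    qed
    finally show ?thesis by (simp add: C_def)
  qed
  have "integral {0..1} (\<lambda>u. f u * f u) \<le> 0"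
  proof (rule field_le_epsilon)
    fix e :: real assume e: "e > 0"
    have "integral {0..1} (\<lambda>u. f u * f u) \<le> (e / (C + 1)) * C"
      using e C by (intro small) auto
    also have "\<dots> \<le> 0 + e" using e C by (simp add: field_simps)
    finally show "integral {0..1} (\<lambda>u. f u * f u) \<le> 0 + e" .
  qed
  moreover have "0 \<le> integral {0..1} (\<lambda>u. f u * f u)"
    by (intro Henstock_Kurzweil_Integration.integral_nonneg int f) auto
  ultimately have "integral {0..1} (\<lambda>u. f u * f u) = 0" by simp
  then have "\<forall>u\<in>{0..1}. f u * f u = 0"
    by (subst (asm) integral_eq_0_iff) (auto intro!: continuous_intros f)
  then show ?thesis using u by auto
qed

lemma summable_inverse_square_pi: "summable (\<lambda>k. 1 / (real (Suc k) * pi)\<^sup>2)"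
proof -
  have "summable (\<lambda>n. 1 / real ((n + 1)\<^sup>2))"
    using inverse_squares_sums by (rule sums_summable)
  then have "summable (\<lambda>n. 1 / real ((n + 1)\<^sup>2) * (1 / pi\<^sup>2))"
    by (rule summable_mult2)
  moreover have "1 / real ((n + 1)\<^sup>2) * (1 / pi\<^sup>2) = 1 / (real (Suc n) * pi)\<^sup>2" for n
    by (simp add: power_mult_distrib)
  ultimately show ?thesis by simp
qed

text \<open>
  Both sides are continuous and have the same cosine coefficients on \<open>{0..1}\<close>; the reflection
  \<open>u \<mapsto> 2 - u\<close> then gives the whole period.
\<close>

lemma cosine_series_quadratic:
  assumes u: "0 \<le> u" "u \<le> 2"
  shows "(\<lambda>k. cos (real (Suc k) * pi * u) / (real (Suc k) * pi)\<^sup>2) sums (1/6 - u/2 + u\<^sup>2/4)"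
proof -
  define b where "b u = 1/6 - u/2 + u\<^sup>2/4" for u :: real
  define g where "g k u = cos (real (Suc k) * pi * u) / (real (Suc k) * pi)\<^sup>2" for k u
  define S where "S u = suminf (\<lambda>k. g k u)" for u
  have gb: "norm (g k u) \<le> 1 / (real (Suc k) * pi)\<^sup>2" for k u
    unfolding g_def by (simp add: divide_right_mono del: of_nat_Suc)
  have lim: "uniform_limit {0..1} (\<lambda>n u. \<Sum>k<n. g k u) S sequentially"
    unfolding S_def by (rule Weierstrass_m_test[OF gb summable_inverse_square_pi])
  have cg: "continuous_on A (g k)" for A k
    unfolding g_def by (intro continuous_intros) auto
  have cS: "continuous_on {0..1} S"
    by (rule uniform_limit_theorem[OF _ lim]) (auto intro!: always_eventually continuous_intros cg)
  have cb: "continuous_on A b" for A unfolding b_def by (intro continuous_intros) auto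
  have Sn: "integral {0..1} (\<lambda>u. S u * cos (real n * pi * u)) = (if n = 0 then 0 else 1 / (2 * (real n * pi)\<^sup>2))" for n
  proof -
    have lim2: "uniform_limit {0..1} (\<lambda>m u. (\<Sum>k<m. g k u) * cos (real n * pi * u)) (\<lambda>u. S u * cos (real n * pi * u)) sequentially"
    proof (rule uniform_lim_mult[OF lim])
      show "uniform_limit {0..1} (\<lambda>m u. cos (real n * pi * u)) (\<lambda>u. cos (real n * pi * u)) sequentially"
        by (rule uniform_limit_const)
      show "bounded (S ` {0..1})"
        by (intro compact_imp_bounded compact_continuous_image cS compact_Icc)
      show "bounded ((\<lambda>u. cos (real n * pi * u)) ` {0..1})"
        by (intro compact_imp_bounded compact_continuous_image continuous_intros compact_Icc)
    qed
    have "continuous_on {0..1} (\<lambda>u. (\<Sum>k<m. g k u) * cos (real n * pi * u))" for m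
      by (intro continuous_intros cg)
    from uniform_limit_integral[OF lim2 this] obtain I J where
      I: "\<And>m. ((\<lambda>u. (\<Sum>k<m. g k u) * cos (real n * pi * u)) has_integral I m) {0..1}"
      and J: "((\<lambda>u. S u * cos (real n * pi * u)) has_integral J) {0..1}" and IJ: "I \<longlonglongrightarrow> J"
      by auto
    have "((\<lambda>u. (\<Sum>k<m. g k u) * cos (real n * pi * u)) has_integral
        (\<Sum>k<m. (if Suc k = n then 1 / (2 * (real n * pi)\<^sup>2) else 0))) {0..1}" for m
      unfolding sum_distrib_right
    proof (rule has_integral_sum)
      fix k
      have "((\<lambda>u. (cos (real (Suc k) * pi * u) * cos (real n * pi * u)) / (real (Suc k) * pi)\<^sup>2) has_integral
         (if Suc k = n then if Suc k = 0 then 1 else 1 / 2 else 0) / (real (Suc k) * pi)\<^sup>2) {0..1}"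
        by (intro has_integral_divide integral_cos_cos_nat_pi)
      then show "((\<lambda>u. g k u * cos (real n * pi * u)) has_integral
          (if Suc k = n then 1 / (2 * (real n * pi)\<^sup>2) else 0)) {0..1}"
        by (cases "Suc k = n") (simp_all add: g_def del: of_nat_Suc)
    qed simp
    then have Im: "I m = (\<Sum>k<m. (if Suc k = n then 1 / (2 * (real n * pi)\<^sup>2) else 0))" for m
      using I has_integral_unique by blast
    have "I m = (if n = 0 then 0 else 1 / (2 * (real n * pi)\<^sup>2))" if "m \<ge> n" for m
    proof (cases n)
      case (Suc n')
      have "I m = (\<Sum>k<m. (if k = n' then 1 / (2 * (real n * pi)\<^sup>2) else 0))"
        unfolding Im Suc by simp
      then show ?thesis using that Suc by simp
    qed (simp add: Im)
    then have "\<forall>\<^sub>F m in sequentially. I m = (if n = 0 then 0 else 1 / (2 * (real n * pi)\<^sup>2))"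
      by (rule eventually_sequentiallyI)
    then have "I \<longlonglongrightarrow> (if n = 0 then 0 else 1 / (2 * (real n * pi)\<^sup>2))"
      by (rule tendsto_eventually)
    then have "J = (if n = 0 then 0 else 1 / (2 * (real n * pi)\<^sup>2))"
      using IJ LIMSEQ_unique by blast
    then show ?thesis using J by (simp add: integral_unique)
  qed
  have bn: "integral {0..1} (\<lambda>u. b u * cos (real n * pi * u)) = (if n = 0 then 0 else 1 / (2 * (real n * pi)\<^sup>2))" for n
  proof (cases "n = 0")
    case True
    define B where "B u = u/6 - u\<^sup>2/4 + u^3/12" for u :: real
    have "(b has_integral B 1 - B 0) {0..1}"
      unfolding B_def b_def
      by (intro fundamental_theorem_of_calculus)
        (auto intro!: derivative_eq_intros simp: power2_eq_square simp flip: has_real_derivative_iff_has_vector_derivative)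
    then show ?thesis using True by (simp add: B_def integral_unique)
  next
    case False
    define c where "c = real n * pi"
    have c: "c \<noteq> 0" using False by (simp add: c_def)
    \<comment> \<open>Antiderivative obtained by integrating by parts twice.\<close>
    define B where "B u = b u * sin (c * u) / c + (u/2 - 1/2) * cos (c * u) / c\<^sup>2 - sin (c * u) / (2 * c^3)" for u
    have "((\<lambda>u. b u * cos (c * u)) has_integral B 1 - B 0) {0..1}"
      unfolding B_def b_def
      by (intro fundamental_theorem_of_calculus)
        (use c in \<open>auto intro!: derivative_eq_intros simp: field_simps power2_eq_square power3_eq_cube
          simp flip: has_real_derivative_iff_has_vector_derivative\<close>)
    then show ?thesis using False by (simp add: B_def c_def integral_unique field_simps)
  qed
  have main: "S u = b u" if "u \<in> {0..1}" for u
  proof -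
    have "b u - S u = 0"
    proof (rule cosine_system_complete[OF _ _ that])
      show "continuous_on {0..1} (\<lambda>u. b u - S u)" by (intro continuous_intros cb cS)
      fix n
      have "integral {0..1} (\<lambda>u. (b u - S u) * cos (real n * pi * u)) =
        integral {0..1} (\<lambda>u. b u * cos (real n * pi * u)) - integral {0..1} (\<lambda>u. S u * cos (real n * pi * u))"
        unfolding left_diff_distrib
        by (intro Henstock_Kurzweil_Integration.integral_diff integrable_continuous_real continuous_intros cb cS)
      then show "integral {0..1} (\<lambda>u. (b u - S u) * cos (real n * pi * u)) = 0"
        by (simp add: bn Sn)
    qed
    then show ?thesis by simp
  qed
  have sums: "(\<lambda>k. g k u) sums S u" for u
    unfolding S_def
    by (intro summable_sums summable_comparison_test'[OF summable_inverse_square_pi gb])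
  show ?thesis
  proof (cases "u \<le> 1")
    case True
    then show ?thesis using sums[of u] main[of u] u by (simp add: g_def b_def)
  next
    case False
    have "cos (real (Suc k) * pi * (2 - u)) = cos (real (Suc k) * pi * u)" for k
    proof -
      have "real (Suc k) * pi * (2 - u) = real (Suc k) * (2 * pi) - real (Suc k) * pi * u"
        by (simp add: algebra_simps)
      also have "cos \<dots> = cos (real (Suc k) * pi * u)"
        unfolding cos_diff using cos_int_2pin[of "int (Suc k)"] sin_int_2pin[of "int (Suc k)"]
        by (simp add: mult.commute del: of_nat_Suc)
      finally show ?thesis .
    qed
    then have "g k (2 - u) = g k u" for k by (simp add: g_def del: of_nat_Suc)
    then have "(\<lambda>k. g k u) sums b (2 - u)"
      using sums[of "2 - u"] main[of "2 - u"] u False by simp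
    also have "b (2 - u) = b u" by (simp add: b_def power2_eq_square field_simps)
    finally show ?thesis by (simp add: g_def b_def)
  qed
qed

text \<open>
  The covariance of Brownian motion on \<open>{0..1}\<close> minus its mean over that interval: \<open>min s t\<close>
  centered in each argument.
\<close>

definition centered_min :: "real \<Rightarrow> real \<Rightarrow> real" where
  "centered_min s t = min s t - (s - s\<^sup>2 / 2) - (t - t\<^sup>2 / 2) + 1 / 3"

text \<open>
  By the product formula for cosines the series splits into the quadratic cosine series at
  \<open>\<bar>s - t\<bar>\<close> and at \<open>s + t\<close>, both of which lie in \<open>{0..2}\<close>.
\<close>

lemma centered_min_cosine_expansion:
  assumes s: "s \<in> {0..1}" and t: "t \<in> {0..1}"
  shows "((\<lambda>k. (1 / (real k * pi)\<^sup>2) * ((sqrt 2 * cos (real k * pi * s)) * (sqrt 2 * cos (real k * pi * t))))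
    has_sum centered_min s t) {1..}"
proof -
  define f where "f k = (1 / (real k * pi)\<^sup>2) * ((sqrt 2 * cos (real k * pi * s)) * (sqrt 2 * cos (real k * pi * t)))" for k
  have f: "f k = cos (real k * pi * \<bar>s - t\<bar>) / (real k * pi)\<^sup>2 + cos (real k * pi * (s + t)) / (real k * pi)\<^sup>2" for k
  proof -
    have "cos (real k * pi * \<bar>s - t\<bar>) = cos (real k * pi * (s - t))"
      by (metis abs_mult abs_of_nat abs_of_nonneg cos_abs_real pi_ge_zero)
    moreover have "(sqrt 2 * cos (real k * pi * s)) * (sqrt 2 * cos (real k * pi * t)) =
        2 * (cos (real k * pi * s) * cos (real k * pi * t))"
      by (simp add: algebra_simps)
    ultimately show ?thesis
      unfolding f_def cos_times_cos by (simp add: algebra_simps add_divide_distrib)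
  qed
  have "(\<lambda>k. f (Suc k)) sums ((1/6 - \<bar>s - t\<bar>/2 + \<bar>s - t\<bar>\<^sup>2/4) + (1/6 - (s + t)/2 + (s + t)\<^sup>2/4))"
    unfolding f by (intro sums_add cosine_series_quadratic) (use s t in auto)
  also have "(1/6 - \<bar>s - t\<bar>/2 + \<bar>s - t\<bar>\<^sup>2/4) + (1/6 - (s + t)/2 + (s + t)\<^sup>2/4) = centered_min s t"
    by (auto simp: centered_min_def min_def abs_if power2_eq_square field_simps)
  finally have "(\<lambda>k. f (Suc k)) sums centered_min s t" .
  moreover have "norm (f (Suc k)) \<le> 2 * (1 / (real (Suc k) * pi)\<^sup>2)" for k
  proof -
    have "norm (f (Suc k)) \<le> 1 / (real (Suc k) * pi)\<^sup>2 + 1 / (real (Suc k) * pi)\<^sup>2"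
      unfolding f by (intro norm_triangle_le add_mono) (simp_all add: divide_right_mono del: of_nat_Suc)
    then show ?thesis by simp
  qed
  then have "summable (\<lambda>k. norm (f (Suc k)))"
    by (intro summable_comparison_test'[OF summable_mult[OF summable_inverse_square_pi]]) simp
  ultimately have "((\<lambda>k. f (Suc k)) has_sum centered_min s t) UNIV"
    by (intro norm_summable_imp_has_sum)
  then have "(f has_sum centered_min s t) (range Suc)"
    by (subst has_sum_reindex) (auto simp: o_def)
  also have "range Suc = {1..}"
    by (auto simp: image_iff) (metis Suc_le_D)
  finally show ?thesis unfolding f_def .
qed

section \<open>Products over the coordinates\<close>

lemma integral_lborel_vec_prod:
  fixes h :: "'n::finite \<Rightarrow> real \<Rightarrow> real"
  assumes h: "\<And>i. integrable lborel (h i)"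
  shows "(LINT t|(lborel :: (real ^ 'n) measure). (\<Prod>i\<in>UNIV. h i (t $ i))) = (\<Prod>i\<in>UNIV. LINT u|lborel. h i u)"
proof -
  interpret product_sigma_finite "\<lambda>_ :: real ^ 'n. lborel :: real measure" by standard
  have [measurable]: "h i \<in> borel_measurable borel" for i
    using borel_measurable_integrable[OF h] by simp
  define ax where "ax i = (axis i 1 :: real ^ 'n)" for i
  have inj: "inj ax" by (auto simp: ax_def inj_def axis_eq_axis)
  have Basis: "(Basis :: (real ^ 'n) set) = range ax"
    by (auto simp: Basis_vec_def ax_def)
  define H where "H b = h (the_inv ax b)" for b
  have H: "H (ax i) = h i" for i by (simp add: H_def the_inv_f_f[OF inj])
  have "(LINT t|(lborel :: (real ^ 'n) measure). (\<Prod>i\<in>UNIV. h i (t $ i))) =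
      (LINT f|(\<Pi>\<^sub>M b\<in>(Basis :: (real ^ 'n) set). lborel). (\<Prod>i\<in>UNIV. h i ((\<Sum>b\<in>Basis. f b *\<^sub>R b) $ i)))"
    by (subst lborel_eq, subst integral_distr) measurable
  also have "\<dots> = (LINT f|(\<Pi>\<^sub>M b\<in>(Basis :: (real ^ 'n) set). lborel). (\<Prod>b\<in>Basis. H b (f b)))"
  proof (rule Bochner_Integration.integral_cong[OF refl])
    fix f :: "real ^ 'n \<Rightarrow> real"
    have "(\<Sum>b\<in>Basis. f b *\<^sub>R b) $ i = f (ax i)" for i
      using inner_sum_left_Basis[of "ax i" f] Basis
      by (simp add: cart_eq_inner_axis ax_def)
    then show "(\<Prod>i\<in>UNIV. h i ((\<Sum>b\<in>Basis. f b *\<^sub>R b) $ i)) = (\<Prod>b\<in>Basis. H b (f b))"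
      unfolding Basis by (subst prod.reindex[OF inj]) (simp add: H)
  qed
  also have "\<dots> = (\<Prod>b\<in>(Basis :: (real ^ 'n) set). LINT u|lborel. H b u)"
    by (rule product_integral_prod) (auto simp: Basis H h)
  also have "\<dots> = (\<Prod>i\<in>UNIV. LINT u|lborel. h i u)"
    unfolding Basis by (subst prod.reindex[OF inj]) (simp add: H)
  finally show ?thesis .
qed

lemma integral_cube_prod:
  fixes f :: "'n::finite \<Rightarrow> real \<Rightarrow> real"
  assumes f: "\<And>i. continuous_on {0..1} (f i)" and I: "\<And>i. (f i has_integral I i) {0..1}"
  shows "(LINT t|cube_measure. (\<Prod>i\<in>UNIV. f i (t $ i))) = (\<Prod>i\<in>UNIV. I i)"
proof -
  have int: "set_integrable lborel {0..1} (f i)" for i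
    by (rule borel_integrable_atLeastAtMost'[OF f])
  have "(LINT t|cube_measure. (\<Prod>i\<in>UNIV. f i (t $ i))) =
      (LINT t|(lborel :: (real ^ 'n) measure). (\<Prod>i\<in>UNIV. indicator {0..1} (t $ i) * f i (t $ i)))"
    by (subst integral_restrict_space)
      (auto simp: prod.distrib indicator_def mem_box_cart intro!: Bochner_Integration.integral_cong)
  also have "\<dots> = (\<Prod>i\<in>UNIV. LINT u|lborel. indicator {0..1} u * f i u)"
    by (rule integral_lborel_vec_prod) (use int in \<open>simp add: set_integrable_def\<close>)
  finally have *: "(LINT t|cube_measure. (\<Prod>i\<in>UNIV. f i (t $ i))) =
      (\<Prod>i\<in>UNIV. LINT u|lborel. indicator {0..1} u * f i u)" .
  have "(LINT u|lborel. indicator {0..1} u * f i u) = I i" for i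
    using set_borel_integral_eq_integral(2)[OF int] I
    by (simp add: set_lebesgue_integral_def integral_unique)
  then show ?thesis unfolding * by simp
qed

lemma prob_space_cube_measure: "prob_space (cube_measure :: (real ^ 'n::finite) measure)"
proof (rule prob_spaceI)
  have "(\<Prod>b\<in>Basis. ((1::real^'n) - 0) \<bullet> b) = 1"
    by (rule prod.neutral) (auto simp: Basis_vec_def inner_axis)
  then show "emeasure (cube_measure :: (real ^ 'n) measure) (space cube_measure) = 1"
    by (subst emeasure_restrict_space)
      (auto simp: space_restrict_space emeasure_lborel_cbox_eq Basis_vec_def inner_axis)
qed

definition cos_eigenvalue :: "('n::finite \<Rightarrow> nat) \<Rightarrow> real" where
  "cos_eigenvalue k = (\<Prod>i\<in>UNIV. 1 / (real (k i) * pi)\<^sup>2)"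

definition cos_eigenfunction :: "('n::finite \<Rightarrow> nat) \<Rightarrow> real ^ 'n \<Rightarrow> real" where
  "cos_eigenfunction k t = (\<Prod>i\<in>UNIV. sqrt 2 * cos (real (k i) * pi * t $ i))"

text \<open>
  The covariance of the fully centered Wiener sheet.
\<close>

definition sheet_kernel :: "real ^ 'n::finite \<Rightarrow> real ^ 'n \<Rightarrow> real" where
  "sheet_kernel s t = (\<Prod>i\<in>UNIV. centered_min (s $ i) (t $ i))"

lemma continuous_on_cos_eigenfunction: "continuous_on A (cos_eigenfunction k)"
  unfolding cos_eigenfunction_def by (intro continuous_intros)

lemma abs_cos_eigenfunction_le:
  fixes k :: "'n::finite \<Rightarrow> nat"
  shows "\<bar>cos_eigenfunction k t\<bar> \<le> sqrt 2 ^ CARD('n)"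
proof -
  have "\<bar>cos_eigenfunction k t\<bar> \<le> (\<Prod>i\<in>(UNIV :: 'n set). sqrt 2)"
    unfolding cos_eigenfunction_def abs_prod
    by (intro prod_mono) (auto simp: abs_mult)
  then show ?thesis by simp
qed

lemma cos_eigenvalue_pos: "(\<And>i. 1 \<le> k i) \<Longrightarrow> 0 < cos_eigenvalue k"
  unfolding cos_eigenvalue_def by (intro prod_pos) (auto simp: Suc_le_eq)

lemma positive_multi_indices_eq_PiE: "{k. \<forall>i. 1 \<le> k i} = (PiE UNIV (\<lambda>_. {1..}) :: ('n \<Rightarrow> nat) set)"
  by (auto simp: PiE_def Pi_def)

text \<open>
  The product of the one-dimensional sums is not zero, whereas \<open>infsum\<close> of a non-summable
  family would be zero.
\<close>

lemma cos_eigenvalue_summable: "cos_eigenvalue summable_on {k :: 'n::finite \<Rightarrow> nat. \<forall>i. 1 \<le> k i}"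
proof (rule ccontr)
  assume not: "\<not> ?thesis"
  define g where "g k = 1 / (real k * pi)\<^sup>2" for k
  have "g summable_on range Suc"
    using norm_summable_imp_summable_on[of "\<lambda>k. g (Suc k)"] summable_inverse_square_pi
    by (subst summable_on_reindex) (auto simp: g_def o_def)
  also have "range Suc = {1..}"
    by (auto simp: image_iff) (metis Suc_le_D)
  finally have g: "g summable_on {1..}" .
  then have "(\<lambda>k. norm (g k)) summable_on {1..}"
    by (simp add: g_def[abs_def])
  then have "infsum (\<lambda>k. \<Prod>i\<in>UNIV. g (k i)) (PiE (UNIV :: 'n set) (\<lambda>_. {1..})) = (\<Prod>i\<in>(UNIV :: 'n set). infsum g {1..})"
    using infsum_prod_PiE_abs[of "UNIV :: 'n set" "\<lambda>_. g" "\<lambda>_. {1..}"] by simp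
  moreover have "infsum (\<lambda>k. \<Prod>i\<in>UNIV. g (k i)) (PiE (UNIV :: 'n set) (\<lambda>_. {1..})) = 0"
    using not unfolding cos_eigenvalue_def[abs_def] positive_multi_indices_eq_PiE g_def
    by (rule infsum_not_exists)
  moreover have "infsum g {1..} > 0"
  proof -
    have "sum g {1} \<le> infsum g {1..}"
      by (intro finite_sum_le_infsum g) (auto simp: g_def)
    moreover have "sum g {1} > 0" by (simp add: g_def)
    ultimately show ?thesis by linarith
  qed
  ultimately show False by simp
qed

text \<open>
  Distributing the product of the \<open>n\<close> one-dimensional expansions over multi-indices is legitimate
  because the resulting family is dominated by a multiple of the summable eigenvalues.
\<close>

lemma sheet_kernel_expansion:
  fixes s t :: "real ^ 'n::finite"
  assumes s: "s \<in> unit_cube" and t: "t \<in> unit_cube"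
  shows "((\<lambda>k. cos_eigenvalue k * (cos_eigenfunction k s * cos_eigenfunction k t)) has_sum sheet_kernel s t)
    {k. \<forall>i. 1 \<le> k i}"
proof -
  define f where "f i k = (1 / (real k * pi)\<^sup>2) *
    ((sqrt 2 * cos (real k * pi * s $ i)) * (sqrt 2 * cos (real k * pi * t $ i)))" for i k
  have f: "(f i has_sum centered_min (s $ i) (t $ i)) {1..}" for i
    unfolding f_def using s t by (intro centered_min_cosine_expansion) (auto simp: mem_box_cart)
  have prod: "cos_eigenvalue k * (cos_eigenfunction k s * cos_eigenfunction k t) = (\<Prod>i\<in>UNIV. f i (k i))" for k
    by (simp only: cos_eigenvalue_def cos_eigenfunction_def f_def prod.distrib[symmetric])
  have le: "norm (\<Prod>i\<in>UNIV. f i (k i)) \<le> (sqrt 2 ^ CARD('n) * sqrt 2 ^ CARD('n)) * cos_eigenvalue k" for k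
  proof -
    have "0 \<le> cos_eigenvalue k" unfolding cos_eigenvalue_def by (intro prod_nonneg) auto
    then show ?thesis
      using mult_mono[OF abs_cos_eigenfunction_le[of k s] abs_cos_eigenfunction_le[of k t]]
      unfolding prod[symmetric] by (simp add: abs_mult mult.commute mult_left_mono)
  qed
  have summ: "(\<lambda>k. \<Prod>i\<in>UNIV. f i (k i)) summable_on PiE UNIV (\<lambda>_. {1..})"
    unfolding positive_multi_indices_eq_PiE[symmetric]
    by (rule abs_summable_summable[OF Infinite_Sum.abs_summable_on_comparison_test'[OF
          summable_on_cmult_right[OF cos_eigenvalue_summable] le]])
  then have "infsum (\<lambda>k. \<Prod>i\<in>UNIV. f i (k i)) (PiE UNIV (\<lambda>_. {1..})) = (\<Prod>i\<in>UNIV. infsum (f i) {1..})"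
    using f by (intro infsum_prod_PiE) (auto dest: has_sum_imp_summable)
  also have "\<dots> = sheet_kernel s t"
    by (simp only: sheet_kernel_def infsumI[OF f])
  finally show ?thesis
    using summ unfolding positive_multi_indices_eq_PiE prod by (metis has_sum_infsum)
qed

lemma orthonormal_cos_eigenfunction:
  "orthonormal_family cube_measure {k :: 'n::finite \<Rightarrow> nat. \<forall>i. 1 \<le> k i} cos_eigenfunction"
proof -
  interpret prob_space "cube_measure :: (real ^ 'n) measure" by (rule prob_space_cube_measure)
  have m: "cos_eigenfunction k \<in> borel_measurable cube_measure" for k :: "'n \<Rightarrow> nat"
    using borel_measurable_continuous_onI[OF continuous_on_cos_eigenfunction]
    by (intro measurable_restrict_space1) simp
  have "integrable cube_measure (\<lambda>t. (cos_eigenfunction k t)\<^sup>2)" for k :: "'n \<Rightarrow> nat"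
  proof (rule integrable_const_bound[where B="(sqrt 2 ^ CARD('n))\<^sup>2"])
    show "AE t in cube_measure. norm ((cos_eigenfunction k t)\<^sup>2) \<le> (sqrt 2 ^ CARD('n))\<^sup>2"
      using abs_le_square_iff[of "cos_eigenfunction k _" "sqrt 2 ^ CARD('n)"] abs_cos_eigenfunction_le[of k]
      by (intro AE_I2) simp
  qed (use m in measurable)
  moreover have "(LINT t|cube_measure. cos_eigenfunction k t * cos_eigenfunction l t) = (if k = l then 1 else 0)"
    if k: "\<forall>i. 1 \<le> k i" and l: "\<forall>i. 1 \<le> l i" for k l :: "'n \<Rightarrow> nat"
  proof -
    have "(LINT t|cube_measure. cos_eigenfunction k t * cos_eigenfunction l t) =
      (LINT t|cube_measure. (\<Prod>i\<in>UNIV. 2 * (cos (real (k i) * pi * t $ i) * cos (real (l i) * pi * t $ i))))"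
    proof (intro Bochner_Integration.integral_cong refl)
      fix t :: "real ^ 'n"
      have "sqrt 2 * a * (sqrt 2 * b) = 2 * (a * b)" for a b :: real by (simp add: algebra_simps)
      then show "cos_eigenfunction k t * cos_eigenfunction l t =
          (\<Prod>i\<in>UNIV. 2 * (cos (real (k i) * pi * t $ i) * cos (real (l i) * pi * t $ i)))"
        unfolding cos_eigenfunction_def prod.distrib[symmetric] by presburger
    qed
    also have "\<dots> = (\<Prod>i\<in>UNIV. 2 * (if k i = l i then if k i = 0 then 1 else 1 / 2 else 0))"
      by (intro integral_cube_prod continuous_intros has_integral_mult_right integral_cos_cos_nat_pi)
    also have "\<dots> = (if k = l then 1 else 0)"
    proof (cases "k = l")
      case True
      then show ?thesis using k by (auto intro!: prod.neutral simp: Suc_le_eq)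
    next
      case False
      then obtain i where "k i \<noteq> l i" by auto
      then show ?thesis using False by (subst prod_zero) (auto intro!: exI[of _ i])
    qed
    finally show ?thesis .
  qed
  ultimately show ?thesis
    using m by (auto simp: orthonormal_family_def square_integrable_def)
qed

lemma continuous_on_sheet_kernel:
  "continuous_on A (\<lambda>(s, t). sheet_kernel s t)"
  unfolding sheet_kernel_def centered_min_def case_prod_beta
  by (intro continuous_intros) auto

section \<open>Eigensystems of kernels with an absolutely convergent expansion\<close>

text \<open>
  The expansion by itself determines all nonzero eigenvalues.  Integrated against an eigenfunction
  \<open>h\<close> for \<open>\<mu>\<close> it represents \<open>\<mu> h\<close> as a uniformly convergent series in the \<open>e k\<close>.  The
  coefficient \<open>c k\<close> of \<open>h\<close> then satisfies \<open>\<mu> * c k = lam k * c k\<close>, so only the terms with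
  \<open>lam k = \<mu>\<close> remain, and dividing by \<open>\<mu>\<close> exhibits \<open>h\<close> as their combination.
\<close>

lemma mercer_eigensystem:
  fixes \<kappa> :: "real ^ 'n \<Rightarrow> real ^ 'n \<Rightarrow> real" and e :: "'k \<Rightarrow> real ^ 'n \<Rightarrow> real"
  assumes prob: "prob_space (cube_measure :: (real ^ 'n) measure)"
    and orth: "orthonormal_family cube_measure K e"
    and bound: "\<And>k t. \<lbrakk>k \<in> K; t \<in> unit_cube\<rbrakk> \<Longrightarrow> \<bar>e k t\<bar> \<le> C"
    and lam: "\<And>k. k \<in> K \<Longrightarrow> 0 < lam k" and summ: "lam summable_on K"
    and meas: "\<And>t. t \<in> unit_cube \<Longrightarrow> (\<lambda>s. \<kappa> s t) \<in> borel_measurable cube_measure"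
    and expansion: "\<And>s t. \<lbrakk>s \<in> unit_cube; t \<in> unit_cube\<rbrakk> \<Longrightarrow> ((\<lambda>k. lam k * (e k s * e k t)) has_sum \<kappa> s t) K"
  shows "fredholm_eigensystem \<kappa> K lam e"
proof -
  define \<mu>c where "\<mu>c = (cube_measure :: (real ^ 'n) measure)"
  have sp[simp]: "space \<mu>c = unit_cube" by (simp add: \<mu>c_def space_restrict_space)
  interpret prob_space \<mu>c unfolding \<mu>c_def by (rule prob)
  define \<tau> where "\<tau> F = infsum lam (K - F)" for F
  have \<tau>0: "(\<tau> \<longlongrightarrow> 0) (finite_subsets_at_top K)"
    unfolding \<tau>_def by (rule infsum_tail_tendsto_0[OF summ])
  have em: "e k \<in> borel_measurable \<mu>c" if "k \<in> K" for k
    using orth that by (simp add: orthonormal_family_def square_integrable_def \<mu>c_def)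
  have on: "(LINT t|\<mu>c. e k t * e l t) = (if k = l then 1 else 0)" if "k \<in> K" "l \<in> K" for k l
    using orth that by (simp add: orthonormal_family_def \<mu>c_def)
  have tail: "\<bar>\<kappa> s t - (\<Sum>k\<in>F. lam k * (e k s * e k t))\<bar> \<le> C\<^sup>2 * \<tau> F"
    if F: "finite F" "F \<subseteq> K" and st: "s \<in> unit_cube" "t \<in> unit_cube" for F s t
  proof -
    have le: "norm (lam k * (e k s * e k t)) \<le> C\<^sup>2 * lam k" if k: "k \<in> K" for k
    proof -
      have "\<bar>e k s\<bar> * \<bar>e k t\<bar> \<le> C * C"
        using bound[OF k st(1)] bound[OF k st(2)] by (intro mult_mono) auto
      then have "\<bar>e k s\<bar> * \<bar>e k t\<bar> * lam k \<le> C * C * lam k"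
        using lam[OF k] by (intro mult_right_mono) auto
      then show ?thesis
        using lam[OF k] by (simp add: abs_mult power2_eq_square mult_ac)
    qed
    have sm: "(\<lambda>k. lam k * (e k s * e k t)) summable_on K"
      using expansion[OF st] by (rule has_sum_imp_summable)
    have "\<kappa> s t - (\<Sum>k\<in>F. lam k * (e k s * e k t)) = infsum (\<lambda>k. lam k * (e k s * e k t)) (K - F)"
      using sm F infsumI[OF expansion[OF st]] by (simp add: infsum_Diff summable_on_finite)
    moreover have "norm (infsum (\<lambda>k. lam k * (e k s * e k t)) (K - F)) \<le> infsum (\<lambda>k. C\<^sup>2 * lam k) (K - F)"
      by (rule norm_infsum_le[OF has_sum_infsum has_sum_infsum])
        (use le summable_on_subset_banach[OF sm] summable_on_subset_banach[OF summ]
          in \<open>auto intro!: summable_on_cmult_right\<close>)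
    moreover have "infsum (\<lambda>k. C\<^sup>2 * lam k) (K - F) = C\<^sup>2 * \<tau> F"
      unfolding \<tau>_def by (rule infsum_cmult_right') 
    ultimately show ?thesis by simp
  qed
  have \<tau>pos: "0 \<le> \<tau> F" for F
    unfolding \<tau>_def using lam by (intro infsum_nonneg) (auto intro: less_imp_le)
  have eint: "integrable \<mu>c (\<lambda>s. e k s * h s)" if "k \<in> K" "integrable \<mu>c h" for k h
  proof (rule Bochner_Integration.integrable_bound[where f="\<lambda>s. C * h s"])
    have "\<bar>e k t\<bar> * \<bar>h t\<bar> \<le> \<bar>C\<bar> * \<bar>h t\<bar>" if "t \<in> unit_cube" for t
      using bound[OF \<open>k \<in> K\<close> that] by (intro mult_right_mono) auto
    then show "AE s in \<mu>c. norm (e k s * h s) \<le> norm (C * h s)"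
      by (intro AE_I2) (simp add: abs_mult)
  qed (use that em in auto)
  \<comment> \<open>Applying the kernel to \<open>h\<close> term by term, with an error that is uniform in \<open>t\<close>.\<close>
  have fred: "\<bar>fredholm \<kappa> h t - (\<Sum>k\<in>F. lam k * (LINT s|\<mu>c. e k s * h s) * e k t)\<bar>
      \<le> C\<^sup>2 * \<tau> F * (LINT s|\<mu>c. \<bar>h s\<bar>)"
    if F: "finite F" "F \<subseteq> K" and t: "t \<in> unit_cube" and h: "integrable \<mu>c h" for F t h
  proof -
    have ih: "integrable \<mu>c (\<lambda>s. \<kappa> s t * h s - (\<Sum>k\<in>F. lam k * (e k s * e k t)) * h s)"
    proof (rule Bochner_Integration.integrable_bound[where f="\<lambda>s. (C\<^sup>2 * \<tau> F) * h s"])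
      show "AE s in \<mu>c. norm (\<kappa> s t * h s - (\<Sum>k\<in>F. lam k * (e k s * e k t)) * h s) \<le> norm ((C\<^sup>2 * \<tau> F) * h s)"
        using tail[OF F _ t] \<tau>pos
        by (intro AE_I2) (simp add: left_diff_distrib[symmetric] abs_mult mult_right_mono)
      show "(\<lambda>s. \<kappa> s t * h s - (\<Sum>k\<in>F. lam k * (e k s * e k t)) * h s) \<in> borel_measurable \<mu>c"
        using meas[OF t] h em F unfolding \<mu>c_def[symmetric]
        by (intro borel_measurable_diff borel_measurable_times borel_measurable_sum) auto
    qed (use h in auto)
    have iT: "integrable \<mu>c (\<lambda>s. lam k * (e k s * e k t) * h s)" if "k \<in> F" for k
      using integrable_mult_right[OF eint[OF _ h, of k], of "lam k * e k t"] that F by (auto simp: mult_ac)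
    then have iS: "integrable \<mu>c (\<lambda>s. (\<Sum>k\<in>F. lam k * (e k s * e k t)) * h s)"
      unfolding sum_distrib_right by (intro Bochner_Integration.integrable_sum)
    have i\<kappa>: "integrable \<mu>c (\<lambda>s. \<kappa> s t * h s)"
      using Bochner_Integration.integrable_add[OF ih iS] by simp
    have "(LINT s|\<mu>c. (\<Sum>k\<in>F. lam k * (e k s * e k t)) * h s) = (\<Sum>k\<in>F. LINT s|\<mu>c. lam k * (e k s * e k t) * h s)"
      unfolding sum_distrib_right by (rule Bochner_Integration.integral_sum[OF iT])
    also have "\<dots> = (\<Sum>k\<in>F. lam k * (LINT s|\<mu>c. e k s * h s) * e k t)"
    proof (rule sum.cong[OF refl])
      fix k
      have "(LINT s|\<mu>c. lam k * (e k s * e k t) * h s) = (LINT s|\<mu>c. (lam k * e k t) * (e k s * h s))"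
        by (simp add: mult_ac)
      then show "(LINT s|\<mu>c. lam k * (e k s * e k t) * h s) = lam k * (LINT s|\<mu>c. e k s * h s) * e k t"
        by simp
    qed
    finally have "fredholm \<kappa> h t - (\<Sum>k\<in>F. lam k * (LINT s|\<mu>c. e k s * h s) * e k t) =
        (LINT s|\<mu>c. \<kappa> s t * h s - (\<Sum>k\<in>F. lam k * (e k s * e k t)) * h s)"
      using i\<kappa> iS by (simp add: fredholm_def \<mu>c_def)
    also have "\<bar>\<dots>\<bar> \<le> (LINT s|\<mu>c. \<bar>\<kappa> s t * h s - (\<Sum>k\<in>F. lam k * (e k s * e k t)) * h s\<bar>)"
      by (rule integral_abs_bound)
    also have "\<dots> \<le> (LINT s|\<mu>c. C\<^sup>2 * \<tau> F * \<bar>h s\<bar>)"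
    proof (rule integral_mono)
      fix s assume "s \<in> space \<mu>c"
      then show "\<bar>\<kappa> s t * h s - (\<Sum>k\<in>F. lam k * (e k s * e k t)) * h s\<bar> \<le> C\<^sup>2 * \<tau> F * \<bar>h s\<bar>"
        using tail[OF F _ t, of s] by (simp add: left_diff_distrib[symmetric] abs_mult mult_right_mono)
    qed (use ih h in auto)
    finally show ?thesis by simp
  qed
  have limit0: "x = y" if "\<And>F. \<lbrakk>finite F; E \<subseteq> F; F \<subseteq> K\<rbrakk> \<Longrightarrow> \<bar>x - y\<bar> \<le> D * \<tau> F" "finite E" "E \<subseteq> K"
    for x y D :: real and E
  proof -
    have "\<forall>\<^sub>F F in finite_subsets_at_top K. \<bar>x - y\<bar> \<le> D * \<tau> F"
      unfolding eventually_finite_subsets_at_top using that by blast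
    moreover have "((\<lambda>F. D * \<tau> F) \<longlongrightarrow> D * 0) (finite_subsets_at_top K)"
      by (intro tendsto_intros \<tau>0)
    ultimately have "\<bar>x - y\<bar> \<le> D * 0"
      by (intro tendsto_lowerbound[where F="finite_subsets_at_top K"]) auto
    then show ?thesis by simp
  qed
  have sq_int: "integrable \<mu>c h" if "square_integrable \<mu>c h" for h
  proof (rule Bochner_Integration.integrable_bound[where f="\<lambda>t. 1 + (h t)\<^sup>2"])
    have "\<bar>x\<bar> \<le> 1 + x\<^sup>2" for x :: real
    proof -
      have "2 * \<bar>x\<bar> \<le> x\<^sup>2 + 1" using sum_squares_bound[of "\<bar>x\<bar>" 1] by simp
      then show ?thesis using abs_ge_zero[of x] by linarith
    qed
    then show "AE t in \<mu>c. norm (h t) \<le> norm (1 + (h t)\<^sup>2)"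
      by (intro AE_I2) (simp add: abs_of_nonneg add_nonneg_nonneg)
  qed (use that in \<open>auto simp: square_integrable_def\<close>)
  have esq: "square_integrable \<mu>c (e k)" if "k \<in> K" for k
    using orth that by (simp add: orthonormal_family_def \<mu>c_def)
  have eigen: "fredholm \<kappa> (e j) t = lam j * e j t" if j: "j \<in> K" and t: "t \<in> unit_cube" for j t
  proof (rule limit0[of "{j}"])
    fix F assume F: "finite F" "{j} \<subseteq> F" "F \<subseteq> K"
    have "(\<Sum>k\<in>F. lam k * (LINT s|\<mu>c. e k s * e j s) * e k t) = (\<Sum>k\<in>F. if k = j then lam j * e j t else 0)"
      using F j on by (intro sum.cong) auto
    then show "\<bar>fredholm \<kappa> (e j) t - lam j * e j t\<bar> \<le> C\<^sup>2 * (LINT s|\<mu>c. \<bar>e j s\<bar>) * \<tau> F"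
      using fred[OF F(1,3) t sq_int[OF esq[OF j]]] F by (simp add: mult_ac)
  qed (use j in auto)
  have fin: "finite {k\<in>K. lam k = \<mu>}" if "\<mu> \<noteq> 0" for \<mu>
  proof (rule ccontr)
    assume inf: "infinite {k\<in>K. lam k = \<mu>}"
    then obtain k where "k \<in> K" "lam k = \<mu>" by (metis (mono_tags, lifting) empty_Collect_eq finite.emptyI)
    then have \<mu>: "\<mu> > 0" using lam by auto
    obtain n :: nat where n: "infsum lam K / \<mu> < n" using reals_Archimedean2 by blast
    obtain G where G: "finite G" "card G = n" "G \<subseteq> {k\<in>K. lam k = \<mu>}"
      using infinite_arbitrarily_large[OF inf] by blast
    have "real n * \<mu> = sum lam G" using G by (simp add: subset_iff)
    also have "\<dots> \<le> infsum lam K"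
      using G lam by (intro finite_sum_le_infsum summ) (auto intro: less_imp_le)
    finally show False using n \<mu> by (simp add: field_simps)
  qed
  have span: "\<exists>c. AE t in cube_measure. h t = (\<Sum>k\<in>{k\<in>K. lam k = \<mu>}. c k * e k t)"
    if \<mu>: "\<mu> \<noteq> 0" and h: "h \<in> fredholm_eigenspace \<kappa> \<mu>" for h \<mu>
  proof -
    define c where "c k = (LINT s|\<mu>c. e k s * h s)" for k
    define L where "L = {k\<in>K. lam k = \<mu>}"
    have hsq: "square_integrable \<mu>c h" and ev: "AE t in \<mu>c. fredholm \<kappa> h t = \<mu> * h t"
      using h unfolding fredholm_eigenspace_def mem_Collect_eq \<mu>c_def[symmetric] by blast+
    have hi: "integrable \<mu>c h" by (rule sq_int[OF hsq])
    have C0: "0 \<le> C" if "k \<in> K" for k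
      using bound[OF that, of 0] by (simp add: mem_box_cart)
    have approx: "AE t in \<mu>c. \<bar>\<mu> * h t - (\<Sum>k\<in>F. lam k * c k * e k t)\<bar> \<le> C\<^sup>2 * \<tau> F * (LINT s|\<mu>c. \<bar>h s\<bar>)"
      if F: "finite F" "F \<subseteq> K" for F
      using ev AE_space
    proof eventually_elim
      case (elim t)
      then show ?case using fred[OF F _ hi, of t] by (simp add: c_def)
    qed
    have coef: "\<mu> * c j = lam j * c j" if j: "j \<in> K" for j
    proof (rule limit0[of "{j}" _ _ "C * (C\<^sup>2 * (LINT s|\<mu>c. \<bar>h s\<bar>))"])
      fix F assume F: "finite F" "{j} \<subseteq> F" "F \<subseteq> K"
      define r where "r t = \<mu> * h t - (\<Sum>k\<in>F. lam k * c k * e k t)" for t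
      have ri: "integrable \<mu>c r"
        unfolding r_def using F
        by (intro Bochner_Integration.integrable_diff Bochner_Integration.integrable_sum integrable_mult_right hi
            sq_int[OF esq]) auto
      have ie: "integrable \<mu>c (\<lambda>t. (lam k * c k) * (e j t * e k t))" if "k \<in> F" for k
        using F that by (intro integrable_mult_right eint sq_int[OF esq] j) auto
      have "e j t * r t = \<mu> * (e j t * h t) - (\<Sum>k\<in>F. (lam k * c k) * (e j t * e k t))" for t
        by (simp add: r_def right_diff_distrib sum_distrib_left mult_ac)
      then have "(LINT t|\<mu>c. e j t * r t) = \<mu> * c j - (\<Sum>k\<in>F. LINT t|\<mu>c. (lam k * c k) * (e j t * e k t))"
        using ie eint[OF j hi] by (simp add: c_def)
      also have "(\<Sum>k\<in>F. LINT t|\<mu>c. (lam k * c k) * (e j t * e k t)) = (\<Sum>k\<in>F. if k = j then lam j * c j else 0)"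
        using F on j by (intro sum.cong) auto
      also have "\<dots> = lam j * c j" using F by simp
      finally have "\<bar>\<mu> * c j - lam j * c j\<bar> = \<bar>LINT t|\<mu>c. e j t * r t\<bar>" by simp
      also have "\<dots> \<le> (LINT t|\<mu>c. \<bar>e j t * r t\<bar>)" by (rule integral_abs_bound)
      also have "\<dots> \<le> (LINT t|\<mu>c. C * (C\<^sup>2 * \<tau> F * (LINT s|\<mu>c. \<bar>h s\<bar>)))"
      proof (rule integral_mono_AE)
        show "AE t in \<mu>c. \<bar>e j t * r t\<bar> \<le> C * (C\<^sup>2 * \<tau> F * (LINT s|\<mu>c. \<bar>h s\<bar>))"
          using approx[OF F(1,3)] AE_space
          by eventually_elim
            (use bound[OF j] C0[OF j] in \<open>auto simp: r_def abs_mult intro!: mult_mono\<close>)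
      qed (use eint[OF j ri] in auto)
      also have "\<dots> = C * (C\<^sup>2 * (LINT s|\<mu>c. \<bar>h s\<bar>)) * \<tau> F"
        using prob_space by simp
      finally show "\<bar>\<mu> * c j - lam j * c j\<bar> \<le> C * (C\<^sup>2 * (LINT s|\<mu>c. \<bar>h s\<bar>)) * \<tau> F" .
    qed (use j in auto)
    have "AE t in \<mu>c. h t = (\<Sum>k\<in>L. c k * e k t)"
      using ev AE_space
    proof eventually_elim
      case (elim t)
      have "\<mu> * h t = \<mu> * (\<Sum>k\<in>L. c k * e k t)"
      proof (rule limit0[of L])
        fix F assume F: "finite F" "L \<subseteq> F" "F \<subseteq> K"
        have "(\<Sum>k\<in>F. lam k * c k * e k t) = (\<Sum>k\<in>L. \<mu> * (c k * e k t))"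
          using F coef
          by (intro sum.mono_neutral_cong_right) (auto simp: L_def subset_iff)
        then show "\<bar>\<mu> * h t - \<mu> * (\<Sum>k\<in>L. c k * e k t)\<bar> \<le> C\<^sup>2 * (LINT s|\<mu>c. \<bar>h s\<bar>) * \<tau> F"
          using fred[OF F(1,3) _ hi, of t] elim by (simp add: c_def sum_distrib_left mult_ac)
      qed (use fin[OF \<mu>] in \<open>auto simp: L_def\<close>)
      then show ?case using \<mu> by simp
    qed
    then show ?thesis unfolding L_def \<mu>c_def by (intro exI)
  qed
  have "e k \<in> fredholm_eigenspace \<kappa> (lam k)" if "k \<in> K" for k
    using esq[OF that] eigen[OF that] unfolding fredholm_eigenspace_def \<mu>c_def
    by (auto intro!: AE_I2 simp: space_restrict_space)
  then show ?thesis
    unfolding fredholm_eigensystem_def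
    using orth lam fin span by (auto intro: less_imp_le)
qed

section \<open>Mean-centering the Wiener sheet\<close>

lemma riemann_sum_tendsto_integral:
  fixes f :: "real \<Rightarrow> real"
  assumes f: "continuous_on {0..1} f"
  shows "(\<lambda>n. (\<Sum>m<Suc n. f (real m / real (Suc n))) / real (Suc n)) \<longlonglongrightarrow> integral {0..1} f"
proof (rule metric_LIMSEQ_I)
  fix e :: real assume e: "e > 0"
  have "uniformly_continuous_on {0..1} f"
    by (rule compact_uniformly_continuous[OF f]) simp
  then obtain d where d: "d > 0" "\<And>u v. \<lbrakk>u \<in> {0..1}; v \<in> {0..1}; dist u v < d\<rbrakk> \<Longrightarrow> dist (f u) (f v) < e / 2"
    unfolding uniformly_continuous_on_def using e by (meson half_gt_zero)
  obtain n0 where n0: "1 / real (Suc n0) < d"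
    using reals_Archimedean[OF d(1)] by (auto simp: inverse_eq_divide)
  show "\<exists>no. \<forall>n\<ge>no. dist ((\<Sum>m<Suc n. f (real m / real (Suc n))) / real (Suc n)) (integral {0..1} f) < e"
  proof (intro exI[of _ n0] allI impI)
    fix n assume n: "n \<ge> n0"
    define N where "N = real (Suc n)"
    have N: "N > 0" by (simp add: N_def)
    have "1 / N \<le> 1 / real (Suc n0)" using n unfolding N_def by (intro divide_left_mono) auto
    then have Nd: "1 / N < d" using n0 by simp
    have split: "M \<le> Suc n \<Longrightarrow> integral {0..real M / N} f = (\<Sum>m<M. integral {real m / N..real (Suc m) / N} f)" for M
    proof (induction M)
      case (Suc M)
      have MN: "real (Suc M) / N \<le> 1" using Suc(2) N by (simp add: N_def divide_le_eq)
      have "integral {0..real M / N} f + integral {real M / N..real (Suc M) / N} f = integral {0..real (Suc M) / N} f"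
        using N MN
        by (intro Henstock_Kurzweil_Integration.integral_combine integrable_continuous_real continuous_on_subset[OF f])
          (auto simp: divide_right_mono)
      then show ?case using Suc by simp
    qed simp
    have part: "\<bar>f (real m / N) / N - integral {real m / N..real (Suc m) / N} f\<bar> \<le> (e / 2) * (1 / N)" if m: "m < Suc n" for m
    proof -
      define a where "a = real m / N"
      define b where "b = real (Suc m) / N"
      have "real (Suc m) \<le> N" unfolding N_def using m by (simp only: of_nat_le_iff Suc_le_eq)
      then have ab: "0 \<le> a" "a \<le> b" "b \<le> 1" "b - a = 1 / N"
        using N unfolding a_def b_def by (auto simp: divide_right_mono divide_le_eq diff_divide_distrib[symmetric])
      have c: "continuous_on {a..b} f" using ab by (intro continuous_on_subset[OF f]) auto
      have "norm (integral {a..b} (\<lambda>u. f u - f a)) \<le> (e / 2) * (b - a)"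
      proof (rule integral_bound)
        show "continuous_on {a..b} (\<lambda>u. f u - f a)" by (intro continuous_intros c)
        show "norm (f u - f a) \<le> e / 2" if "u \<in> {a..b}" for u
          using d(2)[of u a] that ab Nd by (auto simp: dist_real_def intro: less_imp_le)
      qed (rule ab)
      moreover have "integral {a..b} (\<lambda>u. f u - f a) = integral {a..b} f - integral {a..b} (\<lambda>u. f a)"
        by (intro Henstock_Kurzweil_Integration.integral_diff integrable_continuous_real continuous_intros c)
      moreover have "integral {a..b} (\<lambda>u. f a) = f a / N"
        using ab by simp
      ultimately show ?thesis
        using ab(4) unfolding a_def[symmetric] b_def[symmetric] by (simp add: abs_minus_commute)
    qed
    have "integral {0..1} f = (\<Sum>m<Suc n. integral {real m / N..real (Suc m) / N} f)"
      using split[of "Suc n"] N by (simp add: N_def)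
    then have "\<bar>(\<Sum>m<Suc n. f (real m / N)) / N - integral {0..1} f\<bar> =
        \<bar>\<Sum>m<Suc n. f (real m / N) / N - integral {real m / N..real (Suc m) / N} f\<bar>"
      by (simp only: sum_divide_distrib sum_subtractf)
    also have "\<dots> \<le> (\<Sum>m<Suc n. (e / 2) * (1 / N))"
      by (intro order_trans[OF sum_abs] sum_mono part) simp
    also have "\<dots> = e / 2"
      using N by (simp add: N_def[symmetric] del: sum.lessThan_Suc of_nat_Suc)
    also have "\<dots> < e" using e by simp
    finally show "dist ((\<Sum>m<Suc n. f (real m / real (Suc n))) / real (Suc n)) (integral {0..1} f) < e"
      unfolding N_def dist_real_def .
  qed
qed

lemma sum_min_square: "(\<Sum>l<N. \<Sum>m<N. min (real l) (real m)) = (\<Sum>m<N. (real m)\<^sup>2)"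
proof (induction N)
  case (Suc N)
  have gauss: "(\<Sum>m<N. real m) = real N * (real N - 1) / 2" for N
    by (induction N) (auto simp: field_simps)
  have "(\<Sum>m<N. min (real N) (real m)) = (\<Sum>m<N. real m)" "(\<Sum>l<N. min (real l) (real N)) = (\<Sum>m<N. real m)"
    by (auto intro!: sum.cong)
  then have "(\<Sum>l<Suc N. \<Sum>m<Suc N. min (real l) (real m)) =
      (\<Sum>l<N. \<Sum>m<N. min (real l) (real m)) + (\<Sum>m<N. real m) + (\<Sum>m<N. real m) + real N"
    by (simp add: sum.distrib)
  then show ?case
    unfolding Suc gauss by (simp add: power2_eq_square field_simps)
qed simp

lemma integral_min:
  fixes t :: real
  assumes "t \<in> {0..1}"
  shows "integral {0..1} (\<lambda>u. min u t) = t - t\<^sup>2 / 2"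
proof -
  have "((\<lambda>u. u) has_integral t\<^sup>2 / 2 - 0\<^sup>2 / 2) {0..t}"
    using assms by (intro fundamental_theorem_of_calculus)
      (auto intro!: derivative_eq_intros simp flip: has_real_derivative_iff_has_vector_derivative)
  then have 1: "((\<lambda>u. min u t) has_integral t\<^sup>2 / 2) {0..t}"
    by (subst has_integral_cong[where g="\<lambda>u. u"]) auto
  have "((\<lambda>u. t) has_integral (1 - t) * t) {t..1}"
    using has_integral_const_real[of t t 1] assms by simp
  then have 2: "((\<lambda>u. min u t) has_integral (1 - t) * t) {t..1}"
    by (subst has_integral_cong[where g="\<lambda>u. t"]) auto
  have "((\<lambda>u. min u t) has_integral t\<^sup>2 / 2 + (1 - t) * t) {0..1}"
    using assms by (intro has_integral_combine[OF _ _ 1 2]) auto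
  then show ?thesis by (simp add: integral_unique power2_eq_square algebra_simps)
qed

text \<open>
  The covariance of the Riemann-sum approximations in one coordinate.  The double sum equals a
  single Riemann sum for \<open>u\<^sup>2\<close>, which explains the constant \<open>1 / 3\<close>.
\<close>

lemma riemann_centered_min:
  assumes s: "s \<in> {0..1}" and t: "t \<in> {0..1}"
  shows "(\<lambda>n. min s t - (\<Sum>m<Suc n. min (real m / real (Suc n)) t) / real (Suc n)
      - (\<Sum>m<Suc n. min s (real m / real (Suc n))) / real (Suc n)
      + (\<Sum>l<Suc n. \<Sum>m<Suc n. min (real l / real (Suc n)) (real m / real (Suc n))) / (real (Suc n))\<^sup>2)
    \<longlonglongrightarrow> centered_min s t"
proof -
  have A: "(\<lambda>n. (\<Sum>m<Suc n. min (real m / real (Suc n)) t) / real (Suc n)) \<longlonglongrightarrow> t - t\<^sup>2 / 2" if "t \<in> {0..1}" for t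
    using riemann_sum_tendsto_integral[of "\<lambda>u. min u t"] integral_min[OF that]
    by (simp add: continuous_intros del: sum.lessThan_Suc of_nat_Suc)
  have B: "(\<lambda>n. (\<Sum>m<Suc n. min s (real m / real (Suc n))) / real (Suc n)) \<longlonglongrightarrow> s - s\<^sup>2 / 2"
    using A[OF s] by (simp add: min.commute del: sum.lessThan_Suc of_nat_Suc)
  have "((\<lambda>u. u\<^sup>2) has_integral 1 ^ 3 / 3 - 0 ^ 3 / (3::real)) {0..1}"
    by (intro fundamental_theorem_of_calculus)
      (auto intro!: derivative_eq_intros simp flip: has_real_derivative_iff_has_vector_derivative)
  then have "integral {0..1} (\<lambda>u::real. u\<^sup>2) = 1 / 3" by (simp add: integral_unique)
  moreover have "(\<lambda>n. (\<Sum>m<Suc n. (real m / real (Suc n))\<^sup>2) / real (Suc n)) \<longlonglongrightarrow> integral {0..1} (\<lambda>u::real. u\<^sup>2)"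
    by (intro riemann_sum_tendsto_integral continuous_intros)
  moreover have "(\<Sum>m<Suc n. (real m / real (Suc n))\<^sup>2) / real (Suc n) =
      (\<Sum>l<Suc n. \<Sum>m<Suc n. min (real l / real (Suc n)) (real m / real (Suc n))) / (real (Suc n))\<^sup>2" for n
  proof -
    define N where "N = Suc n"
    have "(\<Sum>l<N. \<Sum>m<N. min (real l / real N) (real m / real N)) = (\<Sum>l<N. \<Sum>m<N. min (real l) (real m)) / real N"
      by (simp add: sum_divide_distrib min_divide_distrib_right)
    also have "\<dots> = (\<Sum>m<N. (real m)\<^sup>2) / real N" by (simp only: sum_min_square)
    finally show ?thesis
      unfolding N_def[symmetric] by (simp add: sum_divide_distrib power_divide power2_eq_square mult.assoc)
  qed
  ultimately have C: "(\<lambda>n. (\<Sum>l<Suc n. \<Sum>m<Suc n. min (real l / real (Suc n)) (real m / real (Suc n))) / (real (Suc n))\<^sup>2)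
      \<longlonglongrightarrow> 1 / 3"
    by (simp only:)
  have "centered_min s t = min s t - (t - t\<^sup>2 / 2) - (s - s\<^sup>2 / 2) + 1 / 3"
    by (simp add: centered_min_def)
  with tendsto_add[OF tendsto_diff[OF tendsto_diff[OF tendsto_const A[OF t]] B] C, of "min s t"]
  show ?thesis by (simp only:)
qed

definition set_coord :: "'n \<Rightarrow> real ^ 'n \<Rightarrow> real \<Rightarrow> real ^ 'n" where
  "set_coord i t u = (\<chi> j. if j = i then u else t $ j)"

lemma set_coord_nth: "set_coord i t u $ j = (if j = i then u else t $ j)"
  by (simp add: set_coord_def)

lemma set_coord_in_cube:
  "\<lbrakk>t \<in> unit_cube; u \<in> {0..1}\<rbrakk> \<Longrightarrow> set_coord i t u \<in> (unit_cube :: (real ^ 'n::finite) set)"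
  by (auto simp: mem_box_cart set_coord_nth)

lemma continuous_on_set_coord: "continuous_on A (\<lambda>(t, u). set_coord i t u)"
  unfolding set_coord_def case_prod_beta
proof (rule continuous_on_vec_lambda)
  show "continuous_on A (\<lambda>x. if j = i then snd x else fst x $ j)" for j
    by (cases "j = i") (auto intro!: continuous_intros)
qed

lemma mean_center_eq_integral:
  fixes f :: "real ^ 'n::finite \<Rightarrow> real"
  assumes f: "continuous_on unit_cube f" and t: "t \<in> unit_cube"
  shows "continuous_on {0..1} (\<lambda>u. f (set_coord i t u))"
    and "mean_center i f t = f t - integral {0..1} (\<lambda>u. f (set_coord i t u))"
proof -
  show c: "continuous_on {0..1} (\<lambda>u. f (set_coord i t u))"
  proof (rule continuous_on_compose2[OF f])
    show "continuous_on {0..1} (set_coord i t)"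
      unfolding set_coord_def
    proof (rule continuous_on_vec_lambda)
      show "continuous_on {0..1} (\<lambda>u. if j = i then u else t $ j)" for j
        by (cases "j = i") auto
    qed
    show "set_coord i t ` {0..1} \<subseteq> unit_cube"
      using set_coord_in_cube[OF t] by blast
  qed
  show "mean_center i f t = f t - integral {0..1} (\<lambda>u. f (set_coord i t u))"
    using set_borel_integral_eq_integral(2)[OF borel_integrable_atLeastAtMost'[OF c]]
    unfolding mean_center_def set_coord_def by (simp only:)
qed

lemma continuous_on_mean_center:
  fixes f :: "real ^ 'n::finite \<Rightarrow> real"
  assumes f: "continuous_on unit_cube f"
  shows "continuous_on unit_cube (mean_center i f)"
proof -
  have "continuous_on (unit_cube \<times> cbox 0 1) (\<lambda>(t, u). f (set_coord i t u))"
    unfolding case_prod_beta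
    by (rule continuous_on_compose2[OF f continuous_on_set_coord[unfolded case_prod_beta]])
      (auto intro!: set_coord_in_cube)
  then have "continuous_on unit_cube (\<lambda>t. integral (cbox 0 1) (\<lambda>u. f (set_coord i t u)))"
    by (rule integral_continuous_on_param)
  then have "continuous_on unit_cube (\<lambda>t. f t - integral {0..1} (\<lambda>u. f (set_coord i t u)))"
    by (intro continuous_intros f) simp
  then show ?thesis
    using mean_center_eq_integral(2)[OF f] by (simp cong: continuous_on_cong)
qed

text \<open>
  The covariance of the Wiener sheet after centering in the coordinates in \<open>A\<close>.
\<close>

definition partial_kernel :: "'n set \<Rightarrow> real ^ 'n::finite \<Rightarrow> real ^ 'n \<Rightarrow> real" where
  "partial_kernel A s t =
     (\<Prod>i\<in>UNIV. if i \<in> A then centered_min (s $ i) (t $ i) else min (s $ i) (t $ i))"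

text \<open>
  Riemann sums in the coordinate \<open>i\<close> are finite linear combinations of values of the process, so
  they are jointly Gaussian, and they converge on every path by continuity.  Hence the limit is
  Gaussian and its covariance is the limit of the covariances, where \<open>min\<close> is replaced by
  \<open>centered_min\<close> in the factor of the coordinate \<open>i\<close>.
\<close>

lemma mean_center_gaussian_process:
  fixes X :: "real ^ 'n::finite \<Rightarrow> 'a \<Rightarrow> real"
  assumes cont: "\<And>x. x \<in> space M \<Longrightarrow> continuous_on unit_cube (\<lambda>t. X t x)"
    and X: "centered_gaussian_process M unit_cube X"
    and cov: "\<And>s t. \<lbrakk>s \<in> unit_cube; t \<in> unit_cube\<rbrakk> \<Longrightarrow> cov_fun M X s t = partial_kernel A s t"
    and i: "i \<notin> A"
  defines "Y \<equiv> \<lambda>t x. mean_center i (\<lambda>s. X s x) t"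
  shows "centered_gaussian_process M unit_cube Y"
    and "\<lbrakk>s \<in> unit_cube; t \<in> unit_cube\<rbrakk> \<Longrightarrow> cov_fun M Y s t = partial_kernel (insert i A) s t"
proof -
  have M: "prob_space M" using X by (simp add: centered_gaussian_process_def)
  \<comment> \<open>The index \<open>m = Suc n\<close> stands for the point \<open>t\<close> itself, the others for the grid.\<close>
  define p where "p n t m = (if m = Suc n then t else set_coord i t (real m / real (Suc n)))" for n t m
  define c where "c n m = (if m = Suc n then 1 else - 1 / real (Suc n))" for n m
  define Z where "Z n t x = (\<Sum>m\<le>Suc n. c n m * X (p n t m) x)" for n t x
  have p: "p n t m \<in> unit_cube" if "t \<in> unit_cube" "m \<le> Suc n" for n t m
    using that unfolding p_def by (auto intro!: set_coord_in_cube simp: divide_le_eq)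
  have ZG: "centered_gaussian_process M unit_cube (Z n)" for n
    unfolding centered_gaussian_process_def
  proof (intro conjI M allI impI)
    fix F a assume F: "finite F \<and> F \<subseteq> (unit_cube :: (real ^ 'n) set)"
    have "(\<Sum>t\<in>F. a t * Z n t x) = (\<Sum>tm\<in>F \<times> {..Suc n}. (a (fst tm) * c n (snd tm)) * X (p n (fst tm) (snd tm)) x)" for x
      unfolding Z_def sum_distrib_left
      by (subst sum.cartesian_product) (simp add: case_prod_beta mult.assoc)
    then show "centered_normal M (\<lambda>x. \<Sum>t\<in>F. a t * Z n t x)"
      using F p by (simp only:) (rule gaussian_process_sum[OF X]; force)
  qed
  have Zsum: "(\<Sum>m\<le>Suc n. c n m * g (p n t m)) = g t - (\<Sum>m<Suc n. g (set_coord i t (real m / real (Suc n)))) / real (Suc n)"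
    for n t and g :: "real ^ 'n \<Rightarrow> real"
  proof -
    have "(\<Sum>m\<le>Suc n. c n m * g (p n t m)) = (\<Sum>m<Suc n. c n m * g (p n t m)) + g t"
      by (simp add: lessThan_Suc_atMost c_def p_def)
    also have "(\<Sum>m<Suc n. c n m * g (p n t m)) =
        (\<Sum>m<Suc n. - (g (set_coord i t (real m / real (Suc n))) / real (Suc n)))"
      by (intro sum.cong refl) (simp add: c_def p_def)
    finally show ?thesis
      by (simp add: sum_negf sum_divide_distrib del: sum.lessThan_Suc sum.atMost_Suc of_nat_Suc)
  qed
  have lim: "(\<lambda>n. Z n t x) \<longlonglongrightarrow> Y t x" if t: "t \<in> unit_cube" and x: "x \<in> space M" for t x
  proof -
    have "Z n t x = X t x - (\<Sum>m<Suc n. X (set_coord i t (real m / real (Suc n))) x) / real (Suc n)" for n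
      unfolding Z_def by (rule Zsum[of n "\<lambda>r. X r x" t])
    then show ?thesis
      unfolding Y_def mean_center_eq_integral(2)[OF cont[OF x] t]
      by (simp only:)
        (intro tendsto_diff tendsto_const riemann_sum_tendsto_integral mean_center_eq_integral(1) cont x t)
  qed
  have meas: "Y t \<in> borel_measurable M" if t: "t \<in> unit_cube" for t
    by (rule borel_measurable_LIMSEQ_real[OF lim[OF t]])
      (use gaussian_process_measurable[OF ZG t] in auto)
  have AElim: "AE x in M. (\<lambda>n. Z n t x) \<longlonglongrightarrow> Y t x" if t: "t \<in> unit_cube" for t
    by (rule AE_I2) (rule lim[OF t])
  show "centered_gaussian_process M unit_cube Y"
    by (rule gaussian_process_AE_limit(1)[OF ZG meas AElim])
  assume st: "s \<in> unit_cube" "t \<in> unit_cube"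
  have "(\<lambda>n. cov_fun M (Z n) s t) \<longlonglongrightarrow> cov_fun M Y s t"
    by (rule gaussian_process_AE_limit(2)[OF ZG meas AElim st])
  define R where "R = (\<Prod>j\<in>UNIV - {i}. if j \<in> A then centered_min (s $ j) (t $ j) else min (s $ j) (t $ j))"
  have K: "partial_kernel A (p n s l) (p n t m) = R * min (p n s l $ i) (p n t m $ i)" for n l m
  proof -
    have "(\<Prod>j\<in>UNIV - {i}. if j \<in> A then centered_min (p n s l $ j) (p n t m $ j) else min (p n s l $ j) (p n t m $ j)) = R"
      unfolding R_def by (intro prod.cong) (auto simp: p_def set_coord_nth)
    then show ?thesis
      unfolding partial_kernel_def by (subst prod.remove[of _ i]) (auto simp: i mult.commute)
  qed
  have covZ: "cov_fun M (Z n) s t = R * (min (s $ i) (t $ i) - (\<Sum>m<Suc n. min (real m / real (Suc n)) (t $ i)) / real (Suc n)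
      - (\<Sum>m<Suc n. min (s $ i) (real m / real (Suc n))) / real (Suc n)
      + (\<Sum>l<Suc n. \<Sum>m<Suc n. min (real l / real (Suc n)) (real m / real (Suc n))) / (real (Suc n))\<^sup>2)" for n
  proof -
    have "cov_fun M (Z n) s t = (\<Sum>l\<le>Suc n. \<Sum>m\<le>Suc n. c n l * c n m * cov_fun M X (p n s l) (p n t m))"
      unfolding cov_fun_def[of M "Z n"] Z_def
      by (rule gaussian_process_cov_sum[OF X]) (use p st in auto)
    also have "\<dots> = (\<Sum>l\<le>Suc n. \<Sum>m\<le>Suc n. c n l * c n m * (R * min (p n s l $ i) (p n t m $ i)))"
      using p st by (intro sum.cong refl) (simp add: cov K)
    also have "\<dots> = R * (\<Sum>l\<le>Suc n. c n l * (\<Sum>m\<le>Suc n. c n m * min (p n s l $ i) (p n t m $ i)))"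
      by (simp only: sum_distrib_left mult_ac)
    also have "(\<Sum>l\<le>Suc n. c n l * (\<Sum>m\<le>Suc n. c n m * min (p n s l $ i) (p n t m $ i))) =
        (\<Sum>l\<le>Suc n. c n l * (min (p n s l $ i) (t $ i) - (\<Sum>m<Suc n. min (p n s l $ i) (real m / real (Suc n))) / real (Suc n)))"
    proof -
      have "(\<Sum>m\<le>Suc n. c n m * min q (p n t m $ i)) = min q (t $ i) - (\<Sum>m<Suc n. min q (real m / real (Suc n))) / real (Suc n)" for q
        using Zsum[of n "\<lambda>r. min q (r $ i)" t] by (simp only: set_coord_nth if_True simp_thms)
      then show ?thesis by (simp only:)
    qed
    also have "\<dots> = (min (s $ i) (t $ i) - (\<Sum>m<Suc n. min (s $ i) (real m / real (Suc n))) / real (Suc n))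
        - (\<Sum>l<Suc n. min (real l / real (Suc n)) (t $ i) - (\<Sum>m<Suc n. min (real l / real (Suc n)) (real m / real (Suc n))) / real (Suc n)) / real (Suc n)"
      using Zsum[of n "\<lambda>r. min (r $ i) (t $ i) - (\<Sum>m<Suc n. min (r $ i) (real m / real (Suc n))) / real (Suc n)" s]
      by (simp only: set_coord_nth if_True simp_thms)
    finally show ?thesis
      by (simp add: sum_subtractf sum_divide_distrib diff_divide_distrib power2_eq_square
          del: sum.lessThan_Suc of_nat_Suc)
  qed
  have "s $ i \<in> {0..1}" "t $ i \<in> {0..1}" using st by (auto simp: mem_box_cart)
  then have "(\<lambda>n. cov_fun M (Z n) s t) \<longlonglongrightarrow> R * centered_min (s $ i) (t $ i)"
    unfolding covZ by (intro tendsto_mult_left riemann_centered_min)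
  moreover have "R * centered_min (s $ i) (t $ i) = partial_kernel (insert i A) s t"
  proof -
    have "(\<Prod>j\<in>UNIV - {i}. if j \<in> insert i A then centered_min (s $ j) (t $ j) else min (s $ j) (t $ j)) = R"
      unfolding R_def by (intro prod.cong) auto
    then show ?thesis
      unfolding partial_kernel_def by (subst prod.remove[of _ i]) (auto simp: mult.commute)
  qed
  ultimately show "cov_fun M Y s t = partial_kernel (insert i A) s t"
    using \<open>(\<lambda>n. cov_fun M (Z n) s t) \<longlonglongrightarrow> cov_fun M Y s t\<close> LIMSEQ_unique by metis
qed

text \<open>
  Continuity of the paths is carried through the induction because every centering step
  integrates along a path.
\<close>

lemma mean_centered_sheet:
  fixes W :: "real ^ 'n::finite \<Rightarrow> 'a \<Rightarrow> real"
  assumes W: "wiener_sheet M W" and "distinct cs"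
  shows "(\<forall>x\<in>space M. continuous_on unit_cube (\<lambda>t. mean_centered cs W t x)) \<and>
    centered_gaussian_process M unit_cube (mean_centered cs W) \<and>
    (\<forall>s\<in>unit_cube. \<forall>t\<in>unit_cube. cov_fun M (mean_centered cs W) s t = partial_kernel (set cs) s t)"
  using \<open>distinct cs\<close>
proof (induction cs)
  case Nil
  have sub: "(unit_cube :: (real ^ 'n) set) \<subseteq> {t. \<forall>i. 0 \<le> t $ i}"
    by (auto simp: mem_box_cart)
  have eq: "mean_centered [] W = W" by (auto simp: mean_centered_def fun_eq_iff)
  show ?case
    using W sub unfolding eq wiener_sheet_def centered_gaussian_process_def partial_kernel_def
    by (auto simp: subset_iff intro: continuous_on_subset)
next
  case (Cons i cs)
  have eq: "mean_centered (i # cs) W = (\<lambda>t x. mean_center i (\<lambda>s. mean_centered cs W s x) t)"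
    by (auto simp: mean_centered_def fun_eq_iff)
  have IH: "\<And>x. x \<in> space M \<Longrightarrow> continuous_on unit_cube (\<lambda>t. mean_centered cs W t x)"
    "centered_gaussian_process M unit_cube (mean_centered cs W)"
    "\<And>s t. \<lbrakk>s \<in> unit_cube; t \<in> unit_cube\<rbrakk> \<Longrightarrow> cov_fun M (mean_centered cs W) s t = partial_kernel (set cs) s t"
    and i: "i \<notin> set cs"
    using Cons by auto
  note * = mean_center_gaussian_process[OF IH i]
  have "continuous_on unit_cube (mean_center i (\<lambda>s. mean_centered cs W s x))" if "x \<in> space M" for x
    by (rule continuous_on_mean_center[OF IH(1)[OF that]])
  then show ?case
    unfolding eq using * by simp
qed

section \<open>The expansion of the mean-centered Wiener sheet\<close>

lemma sqrt_prod: "sqrt (\<Prod>i\<in>A. f i) = (\<Prod>i\<in>A. sqrt (f i))"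
  by (induction A rule: infinite_finite_induct) (simp_all add: real_sqrt_mult)

lemma sqrt_cos_eigenvalue_times_eigenfunction:
  "sqrt (cos_eigenvalue k) * cos_eigenfunction k t =
     (\<Prod>i\<in>UNIV. sqrt 2 * cos (real (k i) * pi * t $ i) / (real (k i) * pi))"
  unfolding cos_eigenvalue_def cos_eigenfunction_def sqrt_prod prod.distrib[symmetric]
  by (intro prod.cong refl) (simp add: real_sqrt_divide abs_mult)

lemma measurable_cube_measure_id: "(\<lambda>t. t) \<in> borel_measurable (cube_measure :: (real ^ 'n::finite) measure)"
  by (rule measurable_restrict_space1) (rule measurable_ident_sets, simp)

lemma square_integrable_sheet_kernel:
  "square_integrable (cube_measure \<Otimes>\<^sub>M cube_measure) (\<lambda>(s, t :: real ^ 'n::finite). sheet_kernel s t)"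
proof -
  let ?C = "cube_measure :: (real ^ 'n) measure"
  interpret C: prob_space ?C by (rule prob_space_cube_measure)
  interpret pair_prob_space ?C ?C by standard
  have m: "(\<lambda>p. sheet_kernel (fst p) (snd p)) \<in> borel_measurable (?C \<Otimes>\<^sub>M ?C)"
    by (rule borel_measurable_continuous_Pair[where H=sheet_kernel,
          OF measurable_compose[OF measurable_fst measurable_cube_measure_id]
            measurable_compose[OF measurable_snd measurable_cube_measure_id]
            continuous_on_sheet_kernel[unfolded case_prod_beta]])
  have "compact ((\<lambda>p. sheet_kernel (fst p) (snd p)) ` (unit_cube \<times> (unit_cube :: (real ^ 'n) set)))"
    by (intro compact_continuous_image compact_Times compact_cbox
        continuous_on_sheet_kernel[unfolded case_prod_beta])
  then have "bounded ((\<lambda>p. sheet_kernel (fst p) (snd p)) ` (unit_cube \<times> (unit_cube :: (real ^ 'n) set)))"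
    by (rule compact_imp_bounded)
  then obtain B where "\<forall>y\<in>(\<lambda>p. sheet_kernel (fst p) (snd p)) ` (unit_cube \<times> (unit_cube :: (real ^ 'n) set)). norm y \<le> B"
    unfolding bounded_iff by blast
  then have B: "\<bar>sheet_kernel (fst p) (snd p)\<bar> \<le> B" if "p \<in> unit_cube \<times> unit_cube" for p :: "(real ^ 'n) \<times> (real ^ 'n)"
    using that unfolding real_norm_def by blast
  have "integrable (?C \<Otimes>\<^sub>M ?C) (\<lambda>p. (sheet_kernel (fst p) (snd p))\<^sup>2)"
  proof (rule integrable_const_bound[where B="B\<^sup>2"])
    show "AE p in ?C \<Otimes>\<^sub>M ?C. norm ((sheet_kernel (fst p) (snd p))\<^sup>2) \<le> B\<^sup>2"
    proof (rule AE_I2)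
      fix p assume "p \<in> space (?C \<Otimes>\<^sub>M ?C)"
      then have "p \<in> unit_cube \<times> unit_cube" by (simp add: space_pair_measure space_restrict_space)
      from power_mono[OF B[OF this], of 2] show "norm ((sheet_kernel (fst p) (snd p))\<^sup>2) \<le> B\<^sup>2" by simp
    qed
  qed (use m in measurable)
  then show ?thesis using m by (simp add: square_integrable_def case_prod_beta)
qed

theorem theorem1p4:
  fixes M :: "'a measure" and N :: "'b measure"
    and W :: "real ^ 'n \<Rightarrow> 'a \<Rightarrow> real"
    and coords :: "'n list"
    and \<omega> :: "('n \<Rightarrow> nat) \<Rightarrow> 'b \<Rightarrow> real"
  assumes "wiener_sheet M W"
    and "distinct coords" and "set coords = UNIV"
    and "iid_std_normal N {k. \<forall>i. 1 \<le> k i} \<omega>"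
  shows "KL_expansion M (mean_centered coords W) N {k. \<forall>i. 1 \<le> k i} \<omega>
           (\<lambda>k. \<Prod>i\<in>UNIV. 1 / (real (k i) * pi)\<^sup>2)
           (\<lambda>k t. \<Prod>i\<in>UNIV. sqrt 2 * cos (real (k i) * pi * t $ i)) \<and>
         law_eq_series M unit_cube (mean_centered coords W) N {k. \<forall>i. 1 \<le> k i}
           (\<lambda>k t x. \<omega> k x * (\<Prod>i\<in>UNIV. sqrt 2 * cos (real (k i) * pi * t $ i) / (real (k i) * pi)))"
proof -
  define K where "K = {k :: 'n \<Rightarrow> nat. \<forall>i. 1 \<le> k i}"
  define X where "X = mean_centered coords W"
  have X: "centered_gaussian_process M unit_cube X"
    and cov: "\<And>s t. \<lbrakk>s \<in> unit_cube; t \<in> unit_cube\<rbrakk> \<Longrightarrow> cov_fun M X s t = sheet_kernel s t"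
    using mean_centered_sheet[OF assms(1,2)] assms(3)
    by (auto simp: X_def partial_kernel_def sheet_kernel_def)
  have \<omega>: "iid_std_normal N K \<omega>" using assms(4) by (simp add: K_def)
  have lam: "0 < cos_eigenvalue k" if "k \<in> K" for k
    using that by (intro cos_eigenvalue_pos) (simp add: K_def)
  have summ: "cos_eigenvalue summable_on K"
    unfolding K_def by (rule cos_eigenvalue_summable)
  have expansion: "((\<lambda>k. cos_eigenvalue k * (cos_eigenfunction k s * cos_eigenfunction k t)) has_sum sheet_kernel s t) K"
    if "s \<in> unit_cube" "t \<in> unit_cube" for s t
    unfolding K_def using that by (rule sheet_kernel_expansion)
  have law: "law_eq_series M unit_cube X N K (\<lambda>k t x. \<omega> k x * (sqrt (cos_eigenvalue k) * cos_eigenfunction k t))"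
  proof -
    have bound: "(sqrt (cos_eigenvalue k) * cos_eigenfunction k t)\<^sup>2 \<le> (sqrt 2 ^ CARD('n))\<^sup>2 * cos_eigenvalue k"
      if "k \<in> K" "t \<in> unit_cube" for k t
    proof -
      have "(cos_eigenfunction k t)\<^sup>2 \<le> (sqrt 2 ^ CARD('n))\<^sup>2"
        using power_mono[OF abs_cos_eigenfunction_le[of k t], of 2] by simp
      then show ?thesis
        using lam[OF that(1)] by (simp add: power_mult_distrib mult.commute mult_right_mono)
    qed
    show ?thesis
    proof (rule gaussian_series[OF \<omega> bound summable_on_cmult_right[OF summ]])
      fix Z
      assume Z: "\<And>t. t \<in> unit_cube \<Longrightarrow>
          mean_square_sums N K (\<lambda>k x. \<omega> k x * (sqrt (cos_eigenvalue k) * cos_eigenfunction k t)) (Z t)"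
        "centered_gaussian_process N unit_cube Z"
      assume covZ: "\<And>s t. \<lbrakk>s \<in> unit_cube; t \<in> unit_cube\<rbrakk> \<Longrightarrow> cov_fun N Z s t =
          infsum (\<lambda>k. (sqrt (cos_eigenvalue k) * cos_eigenfunction k s) * (sqrt (cos_eigenvalue k) * cos_eigenfunction k t)) K"
      have "cov_fun M X s t = cov_fun N Z s t" if "s \<in> unit_cube" "t \<in> unit_cube" for s t
      proof -
        have "cov_fun N Z s t = infsum (\<lambda>k. cos_eigenvalue k * (cos_eigenfunction k s * cos_eigenfunction k t)) K"
          unfolding covZ[OF that]
        proof (rule infsum_cong)
          fix k assume "k \<in> K"
          have "sqrt (cos_eigenvalue k) * sqrt (cos_eigenvalue k) = cos_eigenvalue k"
            using lam[OF \<open>k \<in> K\<close>] by simp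
          then show "(sqrt (cos_eigenvalue k) * cos_eigenfunction k s) * (sqrt (cos_eigenvalue k) * cos_eigenfunction k t) =
              cos_eigenvalue k * (cos_eigenfunction k s * cos_eigenfunction k t)"
            by (metis mult.assoc mult.left_commute)
        qed
        then show ?thesis using infsumI[OF expansion[OF that]] cov[OF that] by simp
      qed
      from gaussian_process_law_unique[OF X Z(2) this]
      have "process_law M unit_cube X = process_law N unit_cube Z" .
      then show ?thesis
        unfolding law_eq_series_def using Z(1) gaussian_process_measurable[OF X] by blast
    qed
  qed
  have "fredholm_eigensystem (cov_fun M X) K cos_eigenvalue cos_eigenfunction"
  proof (rule mercer_eigensystem[OF prob_space_cube_measure _ _ lam summ])
    show "orthonormal_family cube_measure K cos_eigenfunction"
      unfolding K_def by (rule orthonormal_cos_eigenfunction)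
    show "\<bar>cos_eigenfunction k t\<bar> \<le> sqrt 2 ^ CARD('n)" for k and t :: "real ^ 'n"
      by (rule abs_cos_eigenfunction_le)
    show "((\<lambda>k. cos_eigenvalue k * (cos_eigenfunction k s * cos_eigenfunction k t)) has_sum cov_fun M X s t) K"
      if "s \<in> unit_cube" "t \<in> unit_cube" for s t
      using expansion[OF that] cov[OF that] by simp
    fix t :: "real ^ 'n" assume t: "t \<in> unit_cube"
    have "(\<lambda>s. sheet_kernel s t) \<in> borel_measurable cube_measure"
      by (rule borel_measurable_continuous_Pair[where H=sheet_kernel, OF measurable_cube_measure_id
            borel_measurable_const continuous_on_sheet_kernel[unfolded case_prod_beta]])
    then show "(\<lambda>s. cov_fun M X s t) \<in> borel_measurable cube_measure"
      by (subst measurable_cong[where g="\<lambda>s. sheet_kernel s t"]) (auto simp: cov t space_restrict_space)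
  qed
  moreover have "square_integrable (cube_measure \<Otimes>\<^sub>M cube_measure) (\<lambda>(s, t). cov_fun M X s t)"
  proof -
    define P where "P = (cube_measure :: (real ^ 'n) measure) \<Otimes>\<^sub>M (cube_measure :: (real ^ 'n) measure)"
    define f where "f p = (case p of (s, t) \<Rightarrow> cov_fun M X s t)" for p
    define g where "g p = (case p of (s :: real ^ 'n, t :: real ^ 'n) \<Rightarrow> sheet_kernel s t)" for p
    have eq: "f p = g p" if "p \<in> space P" for p
      using that cov by (auto simp: P_def f_def g_def space_pair_measure space_restrict_space)
    have "f \<in> borel_measurable P \<longleftrightarrow> g \<in> borel_measurable P"
      by (rule measurable_cong) (rule eq)
    moreover have "integrable P (\<lambda>p. (f p)\<^sup>2) \<longleftrightarrow> integrable P (\<lambda>p. (g p)\<^sup>2)"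
      by (rule Bochner_Integration.integrable_cong) (simp_all only: eq)
    ultimately have "square_integrable P f \<longleftrightarrow> square_integrable P g"
      unfolding square_integrable_def by (simp only:)
    then show ?thesis
      using square_integrable_sheet_kernel[where ?'n='n] unfolding P_def f_def[abs_def] g_def[abs_def]
      by (simp only:)
  qed
  moreover have "countable K"
    unfolding K_def by (rule countable_subset[OF subset_UNIV]) (rule countableI_type)
  ultimately have "KL_expansion M X N K \<omega> cos_eigenvalue cos_eigenfunction"
    unfolding KL_expansion_def using X \<omega> law by (simp add: mult.assoc)
  from this law show ?thesis
    unfolding X_def K_def sqrt_cos_eigenvalue_times_eigenfunction
    unfolding cos_eigenvalue_def[abs_def] cos_eigenfunction_def[abs_def] by (rule conjI)
qed

end
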